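(* (a) Let $f:\mathbb{R}\to(0,\infty)$ be a symmetric, log-convex density that is uniquely minimized at the origin (i.e. $f(x)>f(0)$ for all $x\neq 0$), and let $0<V_1\le V_2\le V_3$. Then every perimeter-minimizing triple bubble on $\mathbb{R}$ with density $f$ and prescribed volumes $V_1,V_2,V_3$ is, up to reflection and up to permuting the labels of bubbles having equal prescribed volumes, of one of the four types $213$, $3123$, $2313$, $32123$. (b) Moreover, there exists a symmetric, strictly log-convex, $C^1$ density $f$ on $\mathbb{R}$ such that for each of the four types $213$, $3123$, $2313$, $32123$ there are prescribed volumes $0<V_1\le V_2\le V_3$ for which some triple bubble of that type is perimeter minimizing.
   Context: A density on $\mathbb{R}$ is a function $f:\mathbb{R}\to(0,\infty)$. It is symmetric if $f(-x)=f(x)$ for all $x$, and (strictly) log-convex if $\log f$ is (strictly) convex on $\mathbb{R}$. The volume of a set $E\subset\mathbb{R}$ is $\int_E f\,dx$. A triple bubble with prescribed volumes $V_1,V_2,V_3$ is a triple of sets $(E_1,E_2,E_3)$ with pairwise disjoint interiors, each a finite union of compact intervals of positive length, such that $E_a$ has volume $V_a$; $E_a$ is called bubble $a$. The components of bubble $a$ are the connected components (maximal intervals) of $E_a$. The boundary points are the points of $\partial E_1\cup\partial E_2\cup\partial E_3$ (a point common to several $\partial E_a$ is counted once), and the perimeter is the sum of $f(x)$ over all boundary points $x$. A triple bubble is perimeter minimizing if its perimeter is minimal among all triple bubbles with the same prescribed volumes. For a word $n_1n_2\dots n_m$ in the letters $1,2,3$, a triple bubble is of type $n_1n_2\dots n_m$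 if all of its components, listed from left to right, are compact intervals $I_1,\dots,I_m$ that are contiguous (the right endpoint of $I_j$ is the left endpoint of $I_{j+1}$), with $I_j$ a component of bubble $n_j$. "Up to reflection" means that either the triple bubble or its image under $x\mapsto -x$ has the stated type. *)

theory Defs
  imports "HOL-Analysis.Analysis"
begin

definition positive_density :: "(real \<Rightarrow> real) \<Rightarrow> bool" where
  "positive_density f \<longleftrightarrow> (\<forall>x. 0 < f x)"

definition symmetric_density :: "(real \<Rightarrow> real) \<Rightarrow> bool" where
  "symmetric_density f \<longleftrightarrow> (\<forall>x. f (- x) = f x)"

definition log_convex :: "(real \<Rightarrow> real) \<Rightarrow> bool" where
  "log_convex f \<longleftrightarrow> convex_on UNIV (\<lambda>x. ln (f x))"

definition strictly_log_convex :: "(real \<Rightarrow> real) \<Rightarrow> bool" where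
  "strictly_log_convex f \<longleftrightarrow>
     (\<forall>x y t. x \<noteq> y \<longrightarrow> 0 < t \<longrightarrow> t < 1 \<longrightarrow>
        ln (f ((1 - t) * x + t * y)) < (1 - t) * ln (f x) + t * ln (f y))"

definition finite_interval_union :: "real set \<Rightarrow> bool" where
  "finite_interval_union S \<longleftrightarrow>
     (\<exists>J. finite J \<and> (\<forall>(a, b)\<in>J. a < b) \<and> S = (\<Union>(a, b)\<in>J. {a..b}))"

abbreviation labels :: "nat set" where
  "labels \<equiv> {1, 2, 3}"

(* A triple (E_1, E_2, E_3) of sets and a triple (V_1, V_2, V_3) of volumes are functions on nat,
   of which only the values at 1, 2, 3 matter. *)
definition triple_bubble :: "(real \<Rightarrow> real) \<Rightarrow> (nat \<Rightarrow> real) \<Rightarrow> (nat \<Rightarrow> real set) \<Rightarrow> bool" where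
  "triple_bubble f V E \<longleftrightarrow>
     (\<forall>a\<in>labels. finite_interval_union (E a) \<and> integral (E a) f = V a) \<and>
     (\<forall>a\<in>labels. \<forall>b\<in>labels. a \<noteq> b \<longrightarrow> interior (E a) \<inter> interior (E b) = {})"

definition perimeter :: "(real \<Rightarrow> real) \<Rightarrow> (nat \<Rightarrow> real set) \<Rightarrow> real" where
  "perimeter f E = (\<Sum>x\<in>(\<Union>a\<in>labels. frontier (E a)). f x)"

definition perimeter_minimizing ::
    "(real \<Rightarrow> real) \<Rightarrow> (nat \<Rightarrow> real) \<Rightarrow> (nat \<Rightarrow> real set) \<Rightarrow> bool" where
  "perimeter_minimizing f V E \<longleftrightarrow>
     triple_bubble f V E \<and> (\<forall>F. triple_bubble f V F \<longrightarrow> perimeter f E \<le> perimeter f F)"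

(* The j-th listed component, j < length w (counting from 0), is {p ! j .. p ! Suc j}; since p lists
   both endpoints of every interval in increasing order, consecutive intervals are contiguous. *)
definition has_type :: "(nat \<Rightarrow> real set) \<Rightarrow> nat list \<Rightarrow> bool" where
  "has_type E w \<longleftrightarrow> set w \<subseteq> labels \<and>
     (\<exists>p. length p = Suc (length w) \<and> sorted_wrt (<) p \<and>
       (\<forall>a\<in>labels. components (E a) = {{p ! j .. p ! Suc j} | j. j < length w \<and> w ! j = a}))"

definition reflect :: "(nat \<Rightarrow> real set) \<Rightarrow> nat \<Rightarrow> real set" where
  "reflect E a = uminus ` E a"

definition has_type_up_to_reflection_relabelling ::
    "(nat \<Rightarrow> real) \<Rightarrow> (nat \<Rightarrow> real set) \<Rightarrow> nat list \<Rightarrow> bool" where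
  "has_type_up_to_reflection_relabelling V E w \<longleftrightarrow>
     (\<exists>\<sigma>. \<sigma> permutes labels \<and> (\<forall>a\<in>labels. V (\<sigma> a) = V a) \<and>
        (has_type (E \<circ> \<sigma>) w \<or> has_type (reflect (E \<circ> \<sigma>)) w))"

definition four_types :: "nat list set" where
  "four_types = {[2,1,3], [3,1,2,3], [2,3,1,3], [3,2,1,2,3]}"

end

(*  In the volume coordinate t = F x, where F' = f and F 0 = 0, volumes become lengths and the
    perimeter becomes the sum of g = f o inv F over the boundary points.  The density f is log-convex
    exactly when g is convex, since g' = (ln f)'; g is moreover even and increasing away from 0.

    (a) A minimizer has no gaps, and on each side of the origin a label occurs at most once (merge
    two pieces into the outer one) with smaller pieces inside (swap adjacent ones).  Two labels cannot
    occur on both sides in opposite orders.  With a the label at the origin this leaves, up to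
    reflection, the words abc, bac, babc, bacb and cbabc, and for each of them a wrong order of the
    volumes is contradicted by an explicit rearrangement of smaller perimeter.

    (b) Minimizers exist by compactness.  For g t = 1 + t^2 (f = sec^2, near the origin) the perimeter
    of each type is bounded below by an explicit quadratic form in the volumes.  The volumes (1/10,1/10,1/10),
    (1,1,100), (1,20,40), (1,20,80) are chosen so that a configuration of the types 213, 3123, 2313,
    32123 respectively lies below the bounds of the other three types. *)

theory Submission
  imports Defs
begin

section \<open>Optimal arrangements of labelled intervals\<close>

text \<open>The density is only continuous, so g need not be differentiable: its convexity is
  obtained from supporting lines of ln f and applied only as the inequality \<open>g_spread\<close>.
  Competitors may contain pieces of length 0 and repeated points. Dropping these in the actual
  bubble can only lower the perimeter, so rearrangements need no check for degeneracy, and the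
  competitors of one word form a closed set. The obstacle in (a) is the origin: if it is a boundary
  point, both neighbouring pieces are candidates for the centre, and the centre has to be chosen so
  that its label occurs nowhere else. In (b), f = g o F and F' = f turn g t = 1 + t^2 into F' = 1 +
  F^2, hence F = tan and f = sec^2. The volumes fix the differences of boundary points only inside
  certain groups, and a group has the least sum of squares when its mean is 0; this is where the
  quadratic forms come from.\<close>

abbreviation total_length :: "(nat \<times> real) list \<Rightarrow> real" where
  "total_length X \<equiv> sum_list (map snd X)"

primrec label_volume :: "nat \<Rightarrow> (nat \<times> real) list \<Rightarrow> real" where
  "label_volume k [] = 0"
| "label_volume k (p # X) = (if fst p = k then snd p else 0) + label_volume k X"

lemma label_volume_append [simp]:
  "label_volume k (X @ Y) = label_volume k X + label_volume k Y"
  by (induction X) auto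

lemma label_volume_rev [simp]: "label_volume k (rev X) = label_volume k X"
  by (induction X) auto

lemma not_distinct_labels:
  assumes "\<not> distinct (map fst X)"
  obtains P k x Q y S where "X = P @ (k, x) # Q @ (k, y) # S"
proof -
  have "\<exists>P k x Q y S. X = P @ (k, x) # Q @ (k, y) # S" using assms
  proof (induction X)
    case (Cons p X)
    show ?case
    proof (cases "distinct (map fst X)")
      case True
      then obtain y where "(fst p, y) \<in> set X" using Cons.prems by force
      then obtain Q S where "X = Q @ (fst p, y) # S" by (meson split_list)
      then have "p # X = [] @ (fst p, snd p) # Q @ (fst p, y) # S" by simp
      then show ?thesis by blast
    next
      case False
      then obtain P k x Q y S where "X = P @ (k, x) # Q @ (k, y) # S" using Cons.IH by blast
      then have "p # X = (p # P) @ (k, x) # Q @ (k, y) # S" by simp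
      then show ?thesis by blast
    qed
  qed simp
  then show ?thesis using that by blast
qed

text \<open>The encoding of an arrangement: the piece labelled \<open>a\<close> contains the origin,
  which cuts it into lengths \<open>u\<close> on the left and \<open>v\<close> on the right;
  \<open>L\<close> and \<open>R\<close> list the other pieces from the origin outwards. A label
  outside \<open>labels\<close> stands for a gap.\<close>

definition configuration_volume ::
    "nat \<Rightarrow> nat \<Rightarrow> real \<Rightarrow> (nat \<times> real) list \<Rightarrow> real \<Rightarrow> (nat \<times> real) list \<Rightarrow> real" where
  "configuration_volume k a u L v R =
     (if a = k then u + v else 0) + label_volume k L + label_volume k R"

definition ordered_type :: "(nat \<Rightarrow> real) \<Rightarrow> nat list \<Rightarrow> bool" where
  "ordered_type V W \<longleftrightarrow>
     (\<exists>x y z. distinct [x, y, z] \<and> {x, y, z} = labels \<and> V x \<le> V y \<and> V y \<le> V z \<and>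
        (\<exists>W'\<in>{W, rev W}. W' \<in> {[y, x, z], [z, x, y, z], [y, z, x, z], [z, y, x, y, z]}))"

lemma ordered_typeI:
  assumes dist: "x \<noteq> y" "x \<noteq> z" "y \<noteq> z" and lab: "x \<in> labels" "y \<in> labels" "z \<in> labels"
    and V: "V x \<le> V y" "V y \<le> V z"
    and W: "W = W' \<or> W = rev W'"
      "W' = [y, x, z] \<or> W' = [z, x, y, z] \<or> W' = [y, z, x, z] \<or> W' = [z, y, x, y, z]"
  shows "ordered_type V W"
proof -
  have "{x, y, z} = labels"
    using lab by (intro card_subset_eq) (simp_all add: dist)
  moreover have "W' \<in> {W, rev W}" using W(1) by auto
  moreover have "W' \<in> {[y, x, z], [z, x, y, z], [y, z, x, z], [z, y, x, y, z]}" using W(2) by blast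
  moreover have "distinct [x, y, z]" using dist by simp
  ultimately show ?thesis unfolding ordered_type_def using V by blast
qed

lemma ordered_type_rev: "ordered_type V (rev W) \<longleftrightarrow> ordered_type V W"
  unfolding ordered_type_def by (simp add: insert_commute)

lemma two_labels_cases:
  assumes "distinct (map fst X)" "fst ` set X \<subseteq> {b, c}"
  obtains "X = []" | y where "X = [(b, y)]" | z where "X = [(c, z)]"
    | y z where "X = [(b, y), (c, z)]" | y z where "X = [(c, z), (b, y)]"
proof -
  have "card (set (map fst X)) \<le> card {b, c}" using assms(2) by (intro card_mono) auto
  also have "\<dots> \<le> 2" by (simp add: card_insert_if)
  finally have "length X \<le> 2" using distinct_card[OF assms(1)] by simp
  then consider "X = []" | p where "X = [p]" | p q where "X = [p, q]"
    by (cases X; cases "tl X"; cases "tl (tl X)") auto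
  then show ?thesis
  proof cases
    case 2
    then show ?thesis using assms that(2)[of "snd p"] that(3)[of "snd p"] by (cases p) auto
  next
    case 3
    obtain k x l y where pq: "p = (k, x)" "q = (l, y)" by (cases p; cases q) blast
    have "k \<in> {b, c}" "l \<in> {b, c}" "k \<noteq> l" using assms 3 pq by simp_all
    then consider "k = b" "l = c" | "k = c" "l = b" by blast
    then show ?thesis
    proof cases
      case 1
      then show ?thesis using 3 pq that(4) by simp
    next
      case 2
      then show ?thesis using 3 pq that(5) by simp
    qed
  qed (use that in simp)
qed

text \<open>\<open>g\<close> is the density as a function of the volume coordinate.
  \<open>g_spread\<close> is convexity on the nonnegative half-line: two points moved by
  \<open>d\<close> towards each other cost no more in total. They may even pass each other, as long
  as both stay between \<open>l\<close> and \<open>r\<close>.\<close>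

locale perimeter_profile =
  fixes g :: "real \<Rightarrow> real"
  assumes g_zero_pos: "0 < g 0"
    and g_even: "g (- t) = g t"
    and g_strict: "\<lbrakk>0 \<le> s; s < t\<rbrakk> \<Longrightarrow> g s < g t"
    and g_spread: "\<lbrakk>0 \<le> l; 0 \<le> d; l + d \<le> r\<rbrakk> \<Longrightarrow> g (l + d) + g (r - d) \<le> g l + g r"
begin

lemma g_mono: "\<lbrakk>0 \<le> s; s \<le> t\<rbrakk> \<Longrightarrow> g s \<le> g t"
  using g_strict[of s t] by (cases "s = t") auto

lemma g_ge: "g 0 \<le> g t"
  using g_mono[of 0 t] g_mono[of 0 "- t"] g_even[of t] by linarith

lemma g_pos: "0 < g t"
  using g_ge[of t] g_zero_pos by linarith

text \<open>The starting point is charged as well: it is an end of the centre and remains a boundary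
  point when no piece follows.\<close>

primrec side :: "real \<Rightarrow> (nat \<times> real) list \<Rightarrow> real" where
  "side s [] = g s"
| "side s (p # X) = g s + side (s + snd p) X"

lemma side_append:
  "side s (P @ p # Q) = side s P + side (s + total_length P + snd p) Q"
  by (induction P arbitrary: s) (auto simp: algebra_simps)

lemma side_strict:
  "\<lbrakk>0 \<le> s; s < t; \<forall>p\<in>set X. 0 \<le> snd p\<rbrakk> \<Longrightarrow> side s X < side t X"
proof (induction X arbitrary: s t)
  case (Cons p X)
  then have "side (s + snd p) X < side (t + snd p) X" by auto
  then show ?case using g_strict[of s t] Cons.prems by auto
qed (auto simp: g_strict)

lemma side_mono:
  "\<lbrakk>0 \<le> s; s \<le> t; \<forall>p\<in>set X. 0 \<le> snd p\<rbrakk> \<Longrightarrow> side s X \<le> side t X"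
  using side_strict[of s t X] by (cases "s = t") auto

text \<open>One endpoint disappears and the later ones move inwards.\<close>

lemma side_remove:
  "\<lbrakk>0 \<le> s; \<forall>p\<in>set (P @ p # Q). 0 \<le> snd p\<rbrakk> \<Longrightarrow> side s (P @ Q) < side s (P @ p # Q)"
proof (induction P arbitrary: s)
  case Nil
  then show ?case using side_mono[of s "s + snd p" Q] g_pos[of s] by auto
qed (auto simp: add_nonneg_nonneg)

text \<open>Reflecting the row about the origin carries each endpoint t to -t, and \<open>g\<close>
  is even.\<close>

lemma side_reverse: "side s (rev X) = side (- s - total_length X) X"
proof (induction X arbitrary: s)
  case Nil
  then show ?case by (simp add: g_even)
next
  case (Cons p X)
  have "side s (rev (p # X)) = side s (rev X) + g (s + total_length X + snd p)"
    by (simp add: side_append rev_map[symmetric] sum_list_rev)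
  also have "g (s + total_length X + snd p) = g (- (s + total_length X + snd p))"
    by (simp only: g_even)
  finally show ?case using Cons by (simp add: algebra_simps)
qed

text \<open>The origin inside the centre is not charged, so cutting there splits the cost of the row
  exactly. This passes between rows and two-sided arrangements.\<close>

lemma side_centre:
  "side (- u - total_length L) (rev L @ (a, u + v) # R) = side u L + side v R"
  by (simp add: side_append side_reverse rev_map[symmetric] sum_list_rev)

text \<open>Of the centre only \<open>u + v\<close> must be positive, since the origin may be a
  boundary point. Competitors may have gaps and pieces of length 0, so the rearrangements below are
  admissible even when they degenerate.\<close>

definition optimal ::
    "nat \<Rightarrow> real \<Rightarrow> (nat \<times> real) list \<Rightarrow> real \<Rightarrow> (nat \<times> real) list \<Rightarrow> bool" where
  "optimal a u L v R \<longleftrightarrow>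
     0 \<le> u \<and> 0 \<le> v \<and> 0 < u + v \<and> (\<forall>p\<in>set L. 0 < snd p) \<and> (\<forall>p\<in>set R. 0 < snd p) \<and>
     (\<forall>k\<in>labels. 0 < configuration_volume k a u L v R) \<and>
     (\<forall>a' u' L' v' R'.
        0 \<le> u' \<and> 0 \<le> v' \<and> (\<forall>p\<in>set L'. 0 \<le> snd p) \<and> (\<forall>p\<in>set R'. 0 \<le> snd p) \<and>
        (\<forall>k\<in>labels. configuration_volume k a' u' L' v' R' = configuration_volume k a u L v R)
        \<longrightarrow> side u L + side v R \<le> side u' L' + side v' R')"

lemma optimal_mirror: "optimal a u L v R \<Longrightarrow> optimal a v R u L"
proof -
  have "configuration_volume k a u L v R = configuration_volume k a v R u L" for k a u L v R
    by (simp add: configuration_volume_def)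
  moreover have "side u L + side v R = side v R + side u L" for u L v R by simp
  ultimately show "optimal a u L v R \<Longrightarrow> optimal a v R u L"
    unfolding optimal_def by (smt (verit))
qed

lemma optimalD:
  assumes "optimal a u L v R"
  shows "0 \<le> u" "0 \<le> v" "0 < u + v"
    "\<And>p. p \<in> set L \<Longrightarrow> 0 < snd p" "\<And>p. p \<in> set R \<Longrightarrow> 0 < snd p"
    "\<And>k. k \<in> labels \<Longrightarrow> 0 < configuration_volume k a u L v R"
  using assms unfolding optimal_def by blast+

lemma optimal_nonneg:
  assumes "optimal a u L v R"
  shows "0 \<le> u" "0 \<le> v" "\<forall>p\<in>set L. 0 \<le> snd p" "\<forall>p\<in>set R. 0 \<le> snd p"
  using assms unfolding optimal_def by (auto simp: less_imp_le)

lemma optimal_pos: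
  assumes "optimal a u L v R"
  shows "\<forall>p\<in>set L. 0 < snd p" "\<forall>p\<in>set R. 0 < snd p"
  using assms unfolding optimal_def by auto

lemma optimal_le:
  assumes "optimal a u L v R"
    and "\<And>k. k \<in> labels \<Longrightarrow>
          configuration_volume k a' u' L' v' R' = configuration_volume k a u L v R"
    and "0 \<le> u'" "0 \<le> v'" "\<forall>p\<in>set L'. 0 \<le> snd p" "\<forall>p\<in>set R'. 0 \<le> snd p"
  shows "side u L + side v R \<le> side u' L' + side v' R'"
  using assms unfolding optimal_def by blast

section \<open>Gaps, repeated labels and crossings are excluded\<close>

lemma optimal_no_gap:
  assumes opt: "optimal a u L v R" and "p \<in> set R"
  shows "fst p \<in> labels"
proof (rule ccontr)
  assume gap: "fst p \<notin> labels"
  obtain P Q where R: "R = P @ p # Q" using assms(2) by (meson split_list)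
  have gap': "fst p \<noteq> k" if "k \<in> labels" for k using gap that by blast
  have "side u L + side v R \<le> side u L + side v (P @ Q)"
    by (rule optimal_le[OF opt, where a' = a],
        (simp add: configuration_volume_def R gap' del: insert_iff)[1])
      (use optimal_nonneg[OF opt] gap R in auto)
  moreover have "side v (P @ Q) < side v R"
    unfolding R by (rule side_remove) (use optimal_nonneg[OF opt] R in \<open>auto simp: less_imp_le\<close>)
  ultimately show False by simp
qed

text \<open>A gap at the origin is closed by sliding both sides in until their innermost endpoints
  merge at the origin; the first piece of \<open>L\<close> becomes the centre.\<close>

lemma optimal_centre_gap_aux:
  assumes opt: "optimal a u L v R" and "a \<notin> labels"
  shows "L = []"
proof (cases L)
  case (Cons p L')
  have gap: "a \<noteq> k" if "k \<in> labels" for k using assms(2) that by blast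
  have *: "side u L + side v R \<le> side (snd p) L' + side 0 R"
    by (rule optimal_le[OF opt, where a' = "fst p"],
        (simp add: configuration_volume_def Cons gap del: insert_iff)[1])
      (use optimal_nonneg[OF opt] assms(2) Cons in auto)
  have "side (snd p) L' \<le> side (u + snd p) L'" "side 0 R \<le> side v R"
    by (rule side_mono; use optimal_nonneg[OF opt] Cons in \<open>auto simp: less_imp_le\<close>)+
  with * show ?thesis using Cons g_pos[of u] by simp
qed

lemma optimal_centre_label:
  assumes opt: "optimal a u L v R"
  shows "a \<in> labels"
proof (rule ccontr)
  assume "a \<notin> labels"
  then have "L = []" "R = []"
    using optimal_centre_gap_aux opt optimal_mirror by blast+
  then have "configuration_volume 1 a u L v R = 0"
    using \<open>a \<notin> labels\<close> by (auto simp: configuration_volume_def)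
  then show False using optimalD(6)[OF opt, of 1] by simp
qed

text \<open>Two pieces with the same label on one side are merged into the outer one, so that everything
  in between moves towards the origin.\<close>

lemma optimal_distinct:
  assumes opt: "optimal a u L v R"
  shows "distinct (map fst R)"
proof (rule ccontr)
  assume "\<not> distinct (map fst R)"
  then obtain P k x Q y S where R: "R = P @ (k, x) # Q @ (k, y) # S"
    by (rule not_distinct_labels)
  have pos: "0 < x" "0 < y" using optimal_pos[OF opt] R by auto
  have *: "side u L + side v R \<le> side u L + side v ((P @ Q) @ (k, x + y) # S)"
    by (rule optimal_le[OF opt, where a' = a],
        (simp add: configuration_volume_def R del: insert_iff)[1])
      (use optimal_nonneg[OF opt] R pos in auto)
  have "R = (P @ (k, x) # Q) @ (k, y) # S" using R by simp
  then have "side v R = side v (P @ (k, x) # Q) + side (v + total_length (P @ Q) + x + y) S"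
    by (simp only: side_append) (simp add: algebra_simps)
  moreover have "side v ((P @ Q) @ (k, x + y) # S)
      = side v (P @ Q) + side (v + total_length (P @ Q) + x + y) S"
    by (simp only: side_append) (simp add: algebra_simps)
  moreover have "side v (P @ Q) < side v (P @ (k, x) # Q)"
    by (rule side_remove) (use optimal_nonneg[OF opt] R in \<open>auto simp: less_imp_le\<close>)
  ultimately show False using * by simp
qed

text \<open>The part of the centre to the right of the origin is moved out into the other piece
  labelled \<open>a\<close>: the endpoints in between move inwards by \<open>v\<close>, the later
  ones stay.\<close>

lemma optimal_centre_unique:
  assumes opt: "optimal a u L v R" and "0 < v"
  shows "a \<notin> fst ` set R"
proof
  assume "a \<in> fst ` set R"
  then obtain y where "(a, y) \<in> set R" by force
  then obtain P Q where R: "R = P @ (a, y) # Q" by (meson split_list)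
  have pos: "0 < y" using optimal_pos[OF opt] R by auto
  have "side u L + side v R \<le> side u L + side 0 (P @ (a, v + y) # Q)"
    by (rule optimal_le[OF opt, where a' = a],
        (simp add: configuration_volume_def R del: insert_iff)[1])
      (use optimal_nonneg[OF opt] R pos in auto)
  moreover have "side 0 P < side v P"
    by (rule side_strict) (use optimal_nonneg[OF opt] R \<open>0 < v\<close> in \<open>auto simp: less_imp_le\<close>)
  ultimately show False
    unfolding R by (simp add: side_append algebra_simps)
qed

text \<open>If two labels occur on both sides in opposite orders, exchanging equal volumes of them
  between the two sides moves boundary points inwards and none outwards.\<close>

lemma optimal_no_crossing:
  assumes opt: "optimal a u (P' @ (y, l1) # Q' @ (x, l2) # S') v (P @ (x, r1) # Q @ (y, r2) # S)"
  shows False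
proof -
  define d where "d = min l1 r1"
  have pos: "0 < l1" "0 < l2" "0 < r1" "0 < r2" using optimal_pos[OF opt] by auto
  then have d: "0 < d" "d \<le> l1" "d \<le> r1" by (auto simp: d_def)
  note nonneg = optimal_nonneg[OF opt]
  have *: "side u (P' @ (y, l1) # Q' @ (x, l2) # S') + side v (P @ (x, r1) # Q @ (y, r2) # S)
      \<le> side u (P' @ (y, l1 - d) # Q' @ (x, l2 + d) # S')
       + side v (P @ (x, r1 - d) # Q @ (y, r2 + d) # S)"
    by (rule optimal_le[OF opt, where a' = a],
        (simp add: configuration_volume_def del: insert_iff)[1])
      (use nonneg pos d in auto)
  have tl: "0 \<le> total_length P" "0 \<le> total_length P'"
    by (rule sum_list_nonneg; use nonneg in \<open>auto simp: less_imp_le\<close>)+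
  have "side (u + total_length P' + (l1 - d)) Q' < side (u + total_length P' + l1) Q'"
    "side (v + total_length P + (r1 - d)) Q < side (v + total_length P + r1) Q"
    by (rule side_strict; use nonneg pos d tl in \<open>auto simp: less_imp_le\<close>)+
  then show False using * by (simp add: side_append algebra_simps)
qed

text \<open>With \<open>v = 0\<close> the centre is simply the innermost piece on the left, so
  \<open>a\<close> and \<open>y\<close> occur in opposite orders on the two sides. The exchange is
  that of \<open>optimal_no_crossing\<close>, with the centre as the inner left piece.\<close>

lemma optimal_no_crossing_at_origin:
  assumes opt: "optimal a u (P' @ (y, l) # Q') 0 ((y, z) # P @ (a, r) # Q)"
  shows False
proof -
  define d where "d = min u z"
  have pos: "0 < l" "0 < z" "0 < r" "0 < u" using optimal_pos[OF opt] optimalD(3)[OF opt] by auto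
  then have d: "0 < d" "d \<le> u" "d \<le> z" by (auto simp: d_def)
  note nonneg = optimal_nonneg[OF opt]
  have *: "side u (P' @ (y, l) # Q') + side 0 ((y, z) # P @ (a, r) # Q)
      \<le> side (u - d) (P' @ (y, l + d) # Q') + side 0 ((y, z - d) # P @ (a, r + d) # Q)"
    by (rule optimal_le[OF opt, where a' = a],
        (simp add: configuration_volume_def del: insert_iff)[1])
      (use nonneg pos d in auto)
  have "side (u - d) P' < side u P'" "side (z - d) P < side z P"
    by (rule side_strict; use nonneg pos d in \<open>auto simp: less_imp_le\<close>)+
  then show False using * by (simp add: side_append algebra_simps)
qed

text \<open>Exchanging the two pieces moves only the endpoint between them.\<close>

lemma optimal_swap:
  assumes opt: "optimal a u L v (P @ (b, y) # (c, z) # Q)"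
  shows "y \<le> z"
proof (rule ccontr)
  assume "\<not> y \<le> z"
  then have zy: "z < y" by simp
  have pos: "0 < y" "0 < z" using optimal_pos[OF opt] by auto
  have *: "side u L + side v (P @ (b, y) # (c, z) # Q)
      \<le> side u L + side v (P @ (c, z) # (b, y) # Q)"
    by (rule optimal_le[OF opt, where a' = a],
        (simp add: configuration_volume_def del: insert_iff)[1])
      (use optimal_nonneg[OF opt] pos in auto)
  have "0 \<le> total_length P"
    by (rule sum_list_nonneg) (use optimal_nonneg[OF opt] in \<open>auto simp: less_imp_le\<close>)
  then have "g (v + total_length P + z) < g (v + total_length P + y)"
    by (intro g_strict) (use optimal_nonneg[OF opt] zy pos in auto)
  then show False using * by (simp add: side_append algebra_simps)
qed

section \<open>The choice of the centre\<close>

lemma optimal_recentre: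
  assumes opt: "optimal a u L 0 ((y, z) # R)"
  shows "optimal y 0 ((a, u) # L) z R"
proof -
  have "0 < u" using optimalD(3)[OF opt] by simp
  moreover have "configuration_volume k y 0 ((a, u) # L) z R
      = configuration_volume k a u L 0 ((y, z) # R)" for k
    by (simp add: configuration_volume_def)
  ultimately show ?thesis
    using opt unfolding optimal_def by (auto simp: algebra_simps)
qed

text \<open>With \<open>v = 0\<close>, \<open>optimal_centre_unique\<close> has nothing to move on
  the right. If \<open>a\<close> does occur there, the right neighbour of the origin becomes the
  centre instead: its label is absent on the left by \<open>optimal_no_crossing_at_origin\<close>,
  and further out on the right by \<open>optimal_centre_unique\<close>, now with the positive length
  \<open>z\<close>.\<close>

lemma optimal_good_centre_aux:
  assumes opt: "optimal a u L 0 R"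
  shows "\<exists>a' u' L' v' R'. optimal a' u' L' v' R' \<and>
    rev (map fst L') @ a' # map fst R' = rev (map fst L) @ a # map fst R \<and>
    (\<forall>k. configuration_volume k a' u' L' v' R' = configuration_volume k a u L 0 R) \<and>
    a' \<notin> fst ` set L' \<and> a' \<notin> fst ` set R'"
proof (cases "a \<in> fst ` set R")
  case False
  moreover have "a \<notin> fst ` set L"
    using optimal_centre_unique[OF optimal_mirror[OF opt]] optimalD(3)[OF opt] by auto
  ultimately show ?thesis using opt by blast
next
  case True
  then obtain y z R' where R: "R = (y, z) # R'" by (cases R) auto
  have z: "0 < z" using optimal_pos[OF opt] R by auto
  \<comment> \<open>Otherwise the two pieces fuse and the endpoint at the origin is saved.\<close>
  have "y \<noteq> a"
  proof
    assume "y = a"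
    have "side u L + side 0 R \<le> side u L + side z R'"
      by (rule optimal_le[OF opt, where a' = a],
        (simp add: configuration_volume_def R \<open>y = a\<close> del: insert_iff)[1])
      (use optimal_nonneg[OF opt] R z \<open>y = a\<close> in auto)
    then show False using R g_zero_pos by simp
  qed
  then obtain r where "(a, r) \<in> set R'" using True R by force
  then obtain P Q where R': "R' = P @ (a, r) # Q" by (meson split_list)
  have "y \<notin> fst ` set L"
  proof
    assume "y \<in> fst ` set L"
    then obtain l where "(y, l) \<in> set L" by force
    then obtain P' Q' where "L = P' @ (y, l) # Q'" by (meson split_list)
    then show False using optimal_no_crossing_at_origin opt R R' by blast
  qed
  moreover have opt': "optimal y 0 ((a, u) # L) z R'" using optimal_recentre opt R by blast
  moreover have "y \<notin> fst ` set R'" using optimal_centre_unique[OF opt' z] .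
  moreover have "configuration_volume k y 0 ((a, u) # L) z R' = configuration_volume k a u L 0 R" for k
    by (simp add: configuration_volume_def R)
  ultimately show ?thesis using \<open>y \<noteq> a\<close> R
    by (intro exI[of _ y] exI[of _ 0] exI[of _ "(a, u) # L"] exI[of _ z] exI[of _ R']) auto
qed

lemma optimal_good_centre:
  assumes opt: "optimal a u L v R"
  obtains a' u' L' v' R' where "optimal a' u' L' v' R'"
    "rev (map fst L') @ a' # map fst R' = rev (map fst L) @ a # map fst R"
    "\<And>k. configuration_volume k a' u' L' v' R' = configuration_volume k a u L v R"
    "a' \<notin> fst ` set L'" "a' \<notin> fst ` set R'"
proof (cases "u = 0 \<or> v = 0")
  case False
  then have "0 < u" "0 < v" using optimalD[OF opt] by auto
  then have "a \<notin> fst ` set L" "a \<notin> fst ` set R"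
    using optimal_centre_unique opt optimal_mirror by blast+
  then show ?thesis using opt that by blast
next
  case True
  show ?thesis
  proof (cases "v = 0")
    case True
    then show ?thesis using optimal_good_centre_aux[of a u L R] opt that by blast
  next
    case False
    then have "optimal a v R 0 L" using True opt optimal_mirror by blast
    from optimal_good_centre_aux[OF this] obtain a' u' L' v' R' where *: "optimal a' u' L' v' R'"
      "rev (map fst L') @ a' # map fst R' = rev (map fst R) @ a # map fst L"
      "\<forall>k. configuration_volume k a' u' L' v' R' = configuration_volume k a v R 0 L"
      "a' \<notin> fst ` set L'" "a' \<notin> fst ` set R'" by blast
    from arg_cong[OF *(2), of rev]
    have "rev (map fst R') @ a' # map fst L' = rev (map fst L) @ a # map fst R" by simp
    moreover have "u = 0" using True False by simp
    moreover have "configuration_volume k a' v' R' u' L' = configuration_volume k a u L v R" for k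
      using *(3)[rule_format, of k] \<open>u = 0\<close>
      by (cases "a' = k"; cases "a = k") (simp_all add: configuration_volume_def)
    ultimately show ?thesis
      using that[OF optimal_mirror[OF *(1)]] *(4,5) by blast
  qed
qed

section \<open>The order of the volumes, word by word\<close>

lemma optimal_abc:
  assumes opt: "optimal a u [] v [(b, y), (c, z)]"
  shows "y \<le> z" "y \<le> u + v"
proof -
  show "y \<le> z" using optimal_swap[of a u "[]" v "[]" b y c z "[]"] opt by simp
  have pos: "0 < y" "0 < z" using optimal_pos[OF opt] by auto
  note nonneg = optimal_nonneg[OF opt]
  show "y \<le> u + v"
  proof (rule ccontr)
    assume "\<not> y \<le> u + v"
    then have y: "u < v + y" using nonneg by simp
    \<comment> \<open>Moving \<open>c\<close> to the free left end replaces the endpoint at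
      \<open>v + y + z\<close> by one at \<open>u + z\<close>.\<close>
    have "side u [] + side v [(b, y), (c, z)] \<le> side u [(c, z)] + side v [(b, y)]"
      by (rule optimal_le[OF opt, where a' = a],
        (simp add: configuration_volume_def del: insert_iff)[1]) (use nonneg pos in auto)
    moreover have "g (u + z) < g (v + y + z)" using nonneg pos y by (intro g_strict) auto
    ultimately show False by (simp add: algebra_simps)
  qed
qed

text \<open>Exchanging \<open>a\<close> and \<open>b\<close> with their outer ends fixed replaces
  the endpoint at distance \<open>u\<close> by one at distance \<bar>v - y\<bar>, a gain if \<bar>v
  - y\<bar> < u. Given y < u + v, the other possibility is u + y \<le> v; then reflecting the pair
  ba and attaching \<open>c\<close> to its new right end is a gain unless equality holds.\<close>

lemma optimal_bac:
  assumes opt: "optimal a u [(b, y)] v [(c, z)]"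
  shows "u + v \<le> y"
proof (rule ccontr)
  assume "\<not> u + v \<le> y"
  then have y: "y < u + v" by simp
  have pos: "0 < y" "0 < z" using optimal_pos[OF opt] by auto
  note nonneg = optimal_nonneg[OF opt]
  have moved: "side u [(b, y)] + side v [(c, z)] \<le> side u' [] + side v' [(b, y), (c, z)]"
    if "0 \<le> u'" "0 \<le> v'" "u' + v' = u + v" for u' v'
    by (rule optimal_le[OF opt, where a' = a],
        (simp add: configuration_volume_def that del: insert_iff)[1]) (use that pos in auto)
  consider "v < y" | "y \<le> v" "v - y < u" | "u + y < v" | "v = u + y" by linarith
  then show False
  proof cases
    case 1
    \<comment> \<open>The new endpoint between \<open>a\<close> and \<open>b\<close> lies on the
      left, so the centre is now \<open>b\<close>; in the next case it lies on the right and the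
      centre remains \<open>a\<close>.\<close>
    have "side u [(b, y)] + side v [(c, z)] \<le> side (y - v) [(a, u + v)] + side v [(c, z)]"
      by (rule optimal_le[OF opt, where a' = b],
        (simp add: configuration_volume_def del: insert_iff)[1]) (use nonneg pos 1 in auto)
    moreover have "g (y - v) < g u" using 1 y by (intro g_strict) auto
    ultimately show False by (simp add: algebra_simps)
  next
    case 2
    have "g (v - y) < g u" using 2 by (intro g_strict) auto
    then show False using moved[of "u + y" "v - y"] 2 nonneg pos by (simp add: algebra_simps)
  next
    case 3
    have "g (u + y + z) < g (v + z)" using 3 nonneg pos by (intro g_strict) auto
    then show False using moved[of v u] nonneg pos by (simp add: algebra_simps)
  next
    case 4
    \<comment> \<open>Both moves break even, so the reflected row is shifted left by
      \<open>d\<close> in addition. Its left end moves out from \<open>v\<close> to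
      \<open>v + d\<close>, which the inward move of the far end of \<open>c\<close> makes up for by
      convexity; the two endpoints in between gain strictly.\<close>
    define d where "d = min u z"
    have d: "0 < d" "d \<le> u" "d \<le> z" using y 4 pos by (auto simp: d_def)
    have "g (v + d) + g (v + z - d) \<le> g v + g (v + z)"
      using nonneg d by (intro g_spread) auto
    moreover have "g (u - d) < g u" "g (v - d) < g v"
      using nonneg pos d 4 by (auto intro!: g_strict)
    ultimately show False using moved[of "v + d" "u - d"] nonneg d 4 by (simp add: algebra_simps)
  qed
qed

lemma optimal_babc:
  assumes opt: "optimal a u [(b, y1)] v [(b, y2), (c, z)]"
  shows "u + v \<le> z" "z \<le> y1 + y2"
proof -
  have pos: "0 < y1" "0 < y2" "0 < z" using optimal_pos[OF opt] by auto
  note nonneg = optimal_nonneg[OF opt]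
  have yz: "y2 \<le> z" using optimal_swap[of a u "[(b, y1)]" v "[]" b y2 c z "[]"] opt by simp
  \<comment> \<open>Otherwise \<open>a\<close> slides right until it meets \<open>c\<close>, and the
    two pieces of \<open>b\<close> fuse on its left. The endpoints at distances \<open>u\<close> and
    \<open>v\<close> are replaced by a single one at distance \<bar>y2 - u\<bar>, which is at most
    the larger of them.\<close>
  have y2: "u + v < y2"
  proof (rule ccontr)
    assume le: "\<not> u + v < y2"
    show False
    proof (cases "y2 \<le> u")
      case True
      have "side u [(b, y1)] + side v [(b, y2), (c, z)]
          \<le> side (u - y2) [(b, y1 + y2)] + side (v + y2) [(c, z)]"
        by (rule optimal_le[OF opt, where a' = a],
          (simp add: configuration_volume_def del: insert_iff)[1]) (use nonneg pos True in auto)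
      moreover have "g (u - y2) \<le> g u" using pos True by (intro g_mono) auto
      ultimately show False using g_pos[of v] by (simp add: algebra_simps)
    next
      case False
      have "side u [(b, y1)] + side v [(b, y2), (c, z)]
          \<le> side (u + y1) [] + side (y2 - u) [(a, u + v), (c, z)]"
        by (rule optimal_le[OF opt, where a' = b],
          (simp add: configuration_volume_def del: insert_iff)[1]) (use nonneg pos False in auto)
      moreover have "g (y2 - u) \<le> g v" using False le by (intro g_mono) auto
      ultimately show False using g_pos[of u] by (simp add: algebra_simps)
    qed
  qed
  then show "u + v \<le> z" using yz by simp
  show "z \<le> y1 + y2"
  proof (rule ccontr)
    assume "\<not> z \<le> y1 + y2"
    then have z: "y1 + y2 < z" by simp
    show False
    proof (cases "v = 0")
      case False
      then have v: "0 < v" using nonneg by simp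
      \<comment> \<open>The whole row is shifted left by \<open>v\<close>, which brings the endpoint
        at \<open>v\<close> to the origin. The other four endpoints are compared by convexity, the
        inner pair and the outer pair separately.\<close>
      have "side u [(b, y1)] + side v [(b, y2), (c, z)]
          \<le> side (u + v) [(b, y1)] + side 0 [(b, y2), (c, z)]"
        by (rule optimal_le[OF opt, where a' = a],
          (simp add: configuration_volume_def del: insert_iff)[1]) (use nonneg pos in auto)
      moreover have "g 0 < g v" using v by (intro g_strict) auto
      moreover have "g (u + v) + g (v + y2 - v) \<le> g u + g (v + y2)"
        using nonneg pos y2 by (intro g_spread) auto
      moreover have "g (u + y1 + v) + g (v + y2 + z - v) \<le> g (u + y1) + g (v + y2 + z)"
        using nonneg pos y2 z by (intro g_spread) auto
      ultimately show False by (simp add: algebra_simps)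
    next
      case True
      \<comment> \<open>Now an endpoint is already at the origin. Instead, length \<open>u\<close>
        of \<open>b\<close> passes from the right to the left: the endpoint at \<open>y2\<close>
        gains strictly, and the two outer ends are compared by convexity.\<close>
      have "side u [(b, y1)] + side v [(b, y2), (c, z)]
          \<le> side u [(b, y1 + u)] + side v [(b, y2 - u), (c, z)]"
        by (rule optimal_le[OF opt, where a' = a],
          (simp add: configuration_volume_def del: insert_iff)[1]) (use nonneg pos y2 in auto)
      moreover have "g (u + y1 + u) + g (y2 + z - u) \<le> g (u + y1) + g (y2 + z)"
        using nonneg pos y2 z True by (intro g_spread) auto
      moreover have "g (y2 - u) < g y2"
        using nonneg y2 True optimalD(3)[OF opt] by (intro g_strict) auto
      ultimately show False by (simp add: True algebra_simps)
    qed
  qed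
qed

text \<open>A centre of larger volume than a label b on both sides of it changes places with b, the
  outer boundary points of b being kept.\<close>

lemma smaller_centre:
  assumes "0 \<le> u" "0 \<le> v" "0 \<le> w" "w < u + v"
  obtains u' v' where "0 \<le> u'" "u' \<le> u" "0 \<le> v'" "v' \<le> v" "u' + v' = w" "g u' + g v' < g u + g v"
proof -
  define u' v' where "u' = min u w" and "v' = w - u'"
  have *: "0 \<le> u'" "u' \<le> u" "0 \<le> v'" "v' \<le> v" "u' + v' = w" "u' < u \<or> v' < v"
    using assms by (auto simp: u'_def v'_def)
  then have "g u' + g v' < g u + g v"
    using g_mono[of u' u] g_mono[of v' v] g_strict[of u' u] g_strict[of v' v] by auto
  with * that show ?thesis by blast
qed

lemma optimal_bacb:
  assumes opt: "optimal a u [(b, y1)] v [(c, z), (b, y2)]"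
  shows "z \<le> y1 + y2" "u + v \<le> y1 + y2"
proof -
  have pos: "0 < y1" "0 < y2" "0 < z" using optimal_pos[OF opt] by auto
  note nonneg = optimal_nonneg[OF opt]
  show "z \<le> y1 + y2"
    using optimal_swap[of a u "[(b, y1)]" v "[]" c z b y2 "[]"] opt pos by simp
  show "u + v \<le> y1 + y2"
  proof (rule ccontr)
    assume "\<not> u + v \<le> y1 + y2"
    then obtain u' v' where *: "0 \<le> u'" "u' \<le> u" "0 \<le> v'" "v' \<le> v" "u' + v' = y1 + y2"
      "g u' + g v' < g u + g v"
      using smaller_centre[of u v "y1 + y2"] nonneg pos by auto
    have "side u [(b, y1)] + side v [(c, z), (b, y2)]
        \<le> side u' [(a, u + y1 - u')] + side v' [(c, z), (a, v + y2 - v')]"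
      by (rule optimal_le[OF opt, where a' = b],
        (use * in \<open>simp add: configuration_volume_def del: insert_iff\<close>)[1]) (use pos * in auto)
    moreover have "g (v' + z) \<le> g (v + z)" using * pos by (intro g_mono) auto
    ultimately show False using * by (simp add: algebra_simps)
  qed
qed

lemma optimal_cbabc:
  assumes opt: "optimal a u [(b, y1), (c, z1)] v [(b, y2), (c, z2)]"
  shows "y1 + y2 \<le> z1 + z2" "u + v \<le> y1 + y2"
proof -
  have pos: "0 < y1" "0 < y2" "0 < z1" "0 < z2" using optimal_pos[OF opt] by auto
  note nonneg = optimal_nonneg[OF opt]
  have "y2 \<le> z2"
    using optimal_swap[of a u "[(b, y1), (c, z1)]" v "[]" b y2 c z2 "[]"] opt by simp
  moreover have "y1 \<le> z1"
    using optimal_swap[of a v "[(b, y2), (c, z2)]" u "[]" b y1 c z1 "[]"] optimal_mirror[OF opt]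
    by simp
  ultimately show "y1 + y2 \<le> z1 + z2" by simp
  show "u + v \<le> y1 + y2"
  proof (rule ccontr)
    assume "\<not> u + v \<le> y1 + y2"
    then obtain u' v' where *: "0 \<le> u'" "u' \<le> u" "0 \<le> v'" "v' \<le> v" "u' + v' = y1 + y2"
      "g u' + g v' < g u + g v"
      using smaller_centre[of u v "y1 + y2"] nonneg pos by auto
    have "side u [(b, y1), (c, z1)] + side v [(b, y2), (c, z2)]
        \<le> side u' [(a, u + y1 - u'), (c, z1)] + side v' [(a, v + y2 - v'), (c, z2)]"
      by (rule optimal_le[OF opt, where a' = b],
        (use * in \<open>simp add: configuration_volume_def del: insert_iff\<close>)[1]) (use pos * in auto)
    then show False using * by (simp add: algebra_simps)
  qed
qed

section \<open>Classification of the optimal words\<close>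

lemma optimal_word_aux:
  assumes opt: "optimal a u L v R" and V: "V = (\<lambda>k. configuration_volume k a u L v R)"
    and abc: "a \<noteq> b" "a \<noteq> c" "b \<noteq> c" "a \<in> labels" "b \<in> labels" "c \<in> labels"
    and L: "L = [] \<or> (\<exists>y. L = [(b, y)]) \<or> (\<exists>y z. L = [(b, y), (c, z)])"
    and R: "fst ` set R \<subseteq> {b, c}" and le: "length L \<le> length R"
  shows "ordered_type V (rev (map fst L) @ a # map fst R)"
proof -
  have ne: "a \<noteq> b" "a \<noteq> c" "b \<noteq> c" "b \<noteq> a" "c \<noteq> a" "c \<noteq> b" using abc(1-3) by blast+
  note bc = abc(5,6)
  have Vpos: "0 < V b" "0 < V c" unfolding V by (rule optimalD(6)[OF opt], fact bc)+
  note simps = V configuration_volume_def ne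
  \<comment> \<open>The hypotheses are normalisations: \<open>b\<close> names the innermost label of
    \<open>L\<close>, and a reflection makes \<open>R\<close> at least as long as \<open>L\<close>.
    If the sides are too short, \<open>b\<close> or \<open>c\<close> has volume 0; two pieces on
    each side in opposite orders form a crossing.\<close>
  from optimal_distinct[OF opt] R show ?thesis
  proof (cases rule: two_labels_cases)
    case 1
    then show ?thesis using le Vpos by (simp add: simps)
  next
    case (2 y)
    then show ?thesis using L le Vpos by (auto simp: simps)
  next
    case (3 z)
    from L le 3 Vpos obtain y where [simp]: "L = [(b, y)]"
      by (auto simp: simps)
    have "u + v \<le> y" using optimal_bac opt 3 by simp
    moreover have "u + v \<le> z" using optimal_bac[of a v c z u b y] optimal_mirror[OF opt] 3 by simp
    ultimately have *: "V a \<le> V b" "V a \<le> V c" using 3 by (simp_all add: simps)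
    show ?thesis
    proof (cases "V b \<le> V c")
      case True
      show ?thesis
        by (rule ordered_typeI[OF ne(1) ne(2) ne(3) abc(4) abc(5) abc(6), where W' = "[b, a, c]"])
          (use True * 3 in simp_all)
    next
      case False
      show ?thesis
        by (rule ordered_typeI[OF ne(2) ne(1) ne(6) abc(4) abc(6) abc(5), where W' = "[c, a, b]"])
          (use False * 3 in simp_all)
    qed
  next
    case R: (4 y z)
    consider "L = []" | y1 where "L = [(b, y1)]" | y1 z1 where "L = [(b, y1), (c, z1)]"
      using L by blast
    then show ?thesis
    proof cases
      case 1
      then have *: "V b \<le> V a" "V b \<le> V c"
        using optimal_abc[of a u v b y c z] opt R by (simp_all add: simps)
      show ?thesis
      proof (cases "V a \<le> V c")
        case True
        show ?thesis
          by (rule ordered_typeI[OF ne(4) ne(3) ne(2) abc(5) abc(4) abc(6), where W' = "[a, b, c]"])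
            (use True 1 * R in simp_all)
      next
        case False
        show ?thesis
          by (rule ordered_typeI[OF ne(3) ne(4) ne(5) abc(5) abc(6) abc(4), where W' = "[c, b, a]"])
            (use False 1 * R in simp_all)
      qed
    next
      case 2
      then have *: "V a \<le> V c" "V c \<le> V b"
        using optimal_babc[of a u b y1 v y c z] opt R by (simp_all add: simps)
      show ?thesis
        by (rule ordered_typeI[OF ne(2) ne(1) ne(6) abc(4) abc(6) abc(5), where W' = "[c, b, a, b]"])
          (use 2 * R in simp_all)
    next
      case 3
      then have *: "V a \<le> V b" "V b \<le> V c"
        using optimal_cbabc[of a u b y1 c z1 v y z] opt R by (simp_all add: simps)
      show ?thesis
        by (rule ordered_typeI[OF ne(1) ne(2) ne(3) abc(4) abc(5) abc(6), where W' = "[c, b, a, b, c]"])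
          (use 3 * R in simp_all)
    qed
  next
    case R: (5 y z)
    consider "L = []" | y1 where "L = [(b, y1)]" | y1 z1 where "L = [(b, y1), (c, z1)]"
      using L by blast
    then show ?thesis
    proof cases
      case 1
      then have *: "V c \<le> V a" "V c \<le> V b"
        using optimal_abc[of a u v c z b y] opt R by (simp_all add: simps)
      show ?thesis
      proof (cases "V a \<le> V b")
        case True
        show ?thesis
          by (rule ordered_typeI[OF ne(5) ne(6) ne(1) abc(6) abc(4) abc(5), where W' = "[a, c, b]"])
            (use True 1 * R in simp_all)
      next
        case False
        show ?thesis
          by (rule ordered_typeI[OF ne(6) ne(5) ne(4) abc(6) abc(5) abc(4), where W' = "[b, c, a]"])
            (use False 1 * R in simp_all)
      qed
    next
      case 2
      then have *: "V a \<le> V b" "V c \<le> V b"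
        using optimal_bacb[of a u b y1 v c z y] opt R by (simp_all add: simps)
      show ?thesis
      proof (cases "V a \<le> V c")
        case True
        show ?thesis
          by (rule ordered_typeI[OF ne(2) ne(1) ne(6) abc(4) abc(6) abc(5), where W' = "[b, a, c, b]"])
            (use True 2 * R in simp_all)
      next
        case False
        show ?thesis
          by (rule ordered_typeI[OF ne(5) ne(6) ne(1) abc(6) abc(4) abc(5), where W' = "[b, c, a, b]"])
            (use False 2 * R in simp_all)
      qed
    next
      case 3
      then show ?thesis
        using optimal_no_crossing[of a u "[]" b y1 "[]" c z1 "[]" v "[]" z "[]" y "[]"] opt R by simp
    qed
  qed
qed

text \<open>The two labels other than the centre are named after their order in \<open>L\<close>, or
  after that in \<open>R\<close> and with a reflection if \<open>L\<close> is longer.\<close>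

lemma optimal_word:
  assumes opt0: "optimal a0 u0 L0 v0 R0"
    and V0: "V = (\<lambda>k. configuration_volume k a0 u0 L0 v0 R0)"
  shows "ordered_type V (rev (map fst L0) @ a0 # map fst R0)"
proof -
  obtain a u L v R where opt: "optimal a u L v R"
    and word: "rev (map fst L) @ a # map fst R = rev (map fst L0) @ a0 # map fst R0"
    and V: "\<And>k. configuration_volume k a u L v R = configuration_volume k a0 u0 L0 v0 R0"
    and a: "a \<notin> fst ` set L" "a \<notin> fst ` set R"
    by (rule optimal_good_centre[OF opt0]) (rule that)
  have "a \<in> labels" by (rule optimal_centre_label[OF opt])
  have "card (labels - {a}) = 2" using \<open>a \<in> labels\<close> by (simp add: card_Diff_singleton)
  then obtain b c where bc: "labels - {a} = {b, c}" "b \<noteq> c" by (meson card_2_iff)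
  then have "b \<in> labels - {a}" "c \<in> labels - {a}" by simp_all
  then have abc: "a \<noteq> b" "a \<noteq> c" "b \<noteq> c" "a \<in> labels" "b \<in> labels" "c \<in> labels"
    and cb: "c \<noteq> b"
    using bc(2) \<open>a \<in> labels\<close> by blast+
  note acb = abc(2,1) cb abc(4,6,5)
  have "fst ` set L \<subseteq> labels - {a}" "fst ` set R \<subseteq> labels - {a}"
    using optimal_no_gap[OF opt] optimal_no_gap[OF optimal_mirror[OF opt]] a by blast+
  then have sub: "fst ` set L \<subseteq> {b, c}" "fst ` set R \<subseteq> {b, c}"
    and sub': "fst ` set L \<subseteq> {c, b}" "fst ` set R \<subseteq> {c, b}"
    using bc(1) by (simp_all add: insert_commute)
  have V1: "V = (\<lambda>k. configuration_volume k a u L v R)" using V V0 by simp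
  moreover have "configuration_volume k a u L v R = configuration_volume k a v R u L" for k
    by (simp add: configuration_volume_def)
  ultimately have V2: "V = (\<lambda>k. configuration_volume k a v R u L)" by simp
  have cases: "(X = [] \<or> (\<exists>y. X = [(b, y)]) \<or> (\<exists>y z. X = [(b, y), (c, z)]))
      \<or> (X = [] \<or> (\<exists>y. X = [(c, y)]) \<or> (\<exists>y z. X = [(c, y), (b, z)]))"
    if "distinct (map fst X)" "fst ` set X \<subseteq> {b, c}" for X :: "(nat \<times> real) list"
    using that by (cases rule: two_labels_cases) simp_all
  have "ordered_type V (rev (map fst L) @ a # map fst R)"
  proof (cases "length L \<le> length R")
    case True
    from cases[OF optimal_distinct[OF optimal_mirror[OF opt]] sub(1)] show ?thesis
      using optimal_word_aux[OF opt V1 abc _ sub(2) True] optimal_word_aux[OF opt V1 acb _ sub'(2) True]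
      by blast
  next
    case False
    then have le: "length R \<le> length L" by simp
    from cases[OF optimal_distinct[OF opt] sub(2)]
    have "ordered_type V (rev (map fst R) @ a # map fst L)"
      using optimal_word_aux[OF optimal_mirror[OF opt] V2 abc _ sub(1) le]
        optimal_word_aux[OF optimal_mirror[OF opt] V2 acb _ sub'(1) le]
      by blast
    then show ?thesis using ordered_type_rev[of V "rev (map fst L) @ a # map fst R"] by simp
  qed
  then show ?thesis using word by simp
qed

end

section \<open>Tilings by intervals\<close>

text \<open>By finiteness the sets other than \<open>T i\<close> have a closed union, so a connected
  part of the whole that meets \<open>T i\<close> cannot leave it.\<close>

lemma components_disjoint_UN:
  fixes T :: "'i \<Rightarrow> 'a::topological_space set"
  assumes fin: "finite I" and cl: "\<And>i. i \<in> I \<Longrightarrow> closed (T i)"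
    and conn: "\<And>i. i \<in> I \<Longrightarrow> connected (T i)" and ne: "\<And>i. i \<in> I \<Longrightarrow> T i \<noteq> {}"
    and disj: "\<And>i j. i \<in> I \<Longrightarrow> j \<in> I \<Longrightarrow> i \<noteq> j \<Longrightarrow> T i \<inter> T j = {}"
  shows "components (\<Union>i\<in>I. T i) = T ` I"
proof -
  have comp: "connected_component_set (\<Union>i\<in>I. T i) x = T i" if i: "i \<in> I" and x: "x \<in> T i" for i x
  proof
    show "T i \<subseteq> connected_component_set (\<Union>i\<in>I. T i) x"
      by (rule connected_component_maximal) (use i x conn in auto)
    let ?C = "connected_component_set (\<Union>i\<in>I. T i) x"
    let ?D = "\<Union>j\<in>I - {i}. T j"
    have "connected ?C" by simp
    moreover have "?C \<subseteq> T i \<union> ?D"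
      using connected_component_subset[of "\<Union>i\<in>I. T i" x] by blast
    moreover have "T i \<inter> ?D = {}" using disj i by blast
    moreover have "closed ?D" using fin cl by auto
    moreover have "x \<in> ?C" using i x by (auto simp: connected_component_refl_eq)
    ultimately have "?D \<inter> ?C = {}"
      using connected_closedD[of ?C "T i" ?D] cl[OF i] x by blast
    with \<open>?C \<subseteq> T i \<union> ?D\<close> show "?C \<subseteq> T i" by blast
  qed
  show ?thesis
  proof
    show "components (\<Union>i\<in>I. T i) \<subseteq> T ` I"
      using comp by (auto simp: components_def)
    show "T ` I \<subseteq> components (\<Union>i\<in>I. T i)"
    proof
      fix S assume "S \<in> T ` I"
      then obtain i where i: "i \<in> I" "S = T i" by blast
      then obtain x where "x \<in> T i" using ne by blast
      then show "S \<in> components (\<Union>i\<in>I. T i)"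
        using comp[OF i(1)] i by (auto simp: components_iff)
    qed
  qed
qed

lemma frontier_finite_UN_subset:
  "finite I \<Longrightarrow> frontier (\<Union>i\<in>I. T i) \<subseteq> (\<Union>i\<in>I. frontier (T i))"
proof (induction I rule: finite_induct)
  case (insert i I)
  then show ?case using frontier_Un_subset[of "T i" "\<Union>i\<in>I. T i"] by auto
qed simp

lemma frontier_real_interval: "frontier {a..b :: real} \<subseteq> {a, b}"
  by (cases "a \<le> b") (auto simp: frontier_def)

lemma nondecreasing_upto:
  fixes q :: "nat \<Rightarrow> real"
  assumes "\<forall>j<n. q j \<le> q (Suc j)" "i \<le> j" "j \<le> n"
  shows "q i \<le> q j"
  using assms(2,3)
proof (induction rule: dec_induct)
  case (step j)
  then show ?case using assms(1) by (meson Suc_le_lessD le_less order_trans)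
qed simp

lemma increasing_upto:
  fixes q :: "nat \<Rightarrow> real"
  assumes "\<forall>j<n. q j < q (Suc j)" "i < j" "j \<le> n"
  shows "q i < q j"
proof -
  have "q i < q (Suc i)" using assms by auto
  also have "\<dots> \<le> q j" by (rule nondecreasing_upto[of n]) (use assms in \<open>auto simp: less_imp_le\<close>)
  finally show ?thesis .
qed

definition region :: "(nat \<Rightarrow> real) \<Rightarrow> nat list \<Rightarrow> nat \<Rightarrow> real set" where
  "region q w k = (\<Union>j\<in>{j. j < length w \<and> w ! j = k}. {q j .. q (Suc j)})"

definition region_volume :: "(nat \<Rightarrow> real) \<Rightarrow> nat list \<Rightarrow> nat \<Rightarrow> real" where
  "region_volume p w k = (\<Sum>j | j < length w \<and> w ! j = k. p (Suc j) - p j)"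

text \<open>Label 0 marks a gap. Distinct neighbouring labels keep the pieces of one bubble apart,
  so that they are its components; the last clause makes every \<open>q j\<close> a boundary
  point.\<close>

definition tiling :: "(nat \<Rightarrow> real set) \<Rightarrow> (nat \<Rightarrow> real) \<Rightarrow> nat list \<Rightarrow> bool" where
  "tiling E q w \<longleftrightarrow>
     set w \<subseteq> {0, 1, 2, 3} \<and> w \<noteq> [] \<and>
     (\<forall>j<length w. q j < q (Suc j)) \<and> (\<forall>j. Suc j < length w \<longrightarrow> w ! j \<noteq> w ! Suc j) \<and>
     (\<forall>k\<in>labels. E k = region q w k) \<and> (\<Union>k\<in>labels. frontier (E k)) = q ` {..length w}"

lemma tiling_components:
  assumes t: "tiling E q w" and k: "k \<in> labels"
  shows "components (E k) = {{q j .. q (Suc j)} | j. j < length w \<and> w ! j = k}"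
proof -
  have inc: "\<forall>j<length w. q j < q (Suc j)" using t by (simp add: tiling_def)
  have "components (region q w k) = (\<lambda>j. {q j .. q (Suc j)}) ` {j. j < length w \<and> w ! j = k}"
    unfolding region_def
  proof (rule components_disjoint_UN)
    fix i j assume ij: "i \<in> {j. j < length w \<and> w ! j = k}" "j \<in> {j. j < length w \<and> w ! j = k}" "i \<noteq> j"
    have *: "{q i .. q (Suc i)} \<inter> {q j .. q (Suc j)} = {}"
      if "i < j" "j < length w" "w ! i = w ! j" for i j
    proof -
      have "Suc i \<noteq> j" using t that unfolding tiling_def by auto
      then have "q (Suc i) < q j" using that by (intro increasing_upto[OF inc]) auto
      then show ?thesis by auto
    qed
    show "{q i .. q (Suc i)} \<inter> {q j .. q (Suc j)} = {}"
      using *[of i j] *[of j i] ij by (cases "i < j") auto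
  qed (use inc in \<open>auto simp: less_imp_le\<close>)
  then show ?thesis using t k unfolding tiling_def by auto
qed

lemma tiling_has_type:
  assumes t: "tiling E q w" and w: "set w \<subseteq> labels"
  shows "has_type E w"
  unfolding has_type_def
proof (intro conjI exI ballI)
  let ?p = "map q [0..<Suc (length w)]"
  have inc: "\<forall>j<length w. q j < q (Suc j)" using t by (simp add: tiling_def)
  show "length ?p = Suc (length w)" by simp
  show "sorted_wrt (<) ?p"
    unfolding sorted_wrt_iff_nth_less
  proof (intro allI impI)
    fix i j assume ij: "i < j" "j < length ?p"
    then have "q i < q j" by (intro increasing_upto[OF inc]) auto
    then show "?p ! i < ?p ! j" using ij by (simp del: upt_Suc)
  qed
  fix k assume "k \<in> labels"
  then have "components (E k) = {{q j .. q (Suc j)} | j. j < length w \<and> w ! j = k}"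
    using tiling_components t by blast
  also have "\<dots> = {{?p ! j .. ?p ! Suc j} | j. j < length w \<and> w ! j = k}"
    by (intro Collect_cong ex_cong1) (auto simp del: upt_Suc)
  finally show "components (E k) = {{?p ! j .. ?p ! Suc j} | j. j < length w \<and> w ! j = k}" .
qed (rule w)

lemma finite_interval_union_frontier:
  assumes "finite_interval_union S"
  shows "finite (frontier S)" "closed S" "bounded S"
proof -
  obtain J where J: "finite J" "S = (\<Union>x\<in>J. {fst x..snd x})"
    using assms unfolding finite_interval_union_def by (auto simp: case_prod_unfold)
  have "frontier S \<subseteq> (\<Union>x\<in>J. frontier {fst x..snd x})"
    unfolding J(2) by (rule frontier_finite_UN_subset[OF J(1)])
  also have "\<dots> \<subseteq> (\<Union>x\<in>J. {fst x, snd x})"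
    by (intro UN_mono frontier_real_interval order_refl)
  finally have "frontier S \<subseteq> (\<Union>x\<in>J. {fst x, snd x})" .
  then show "finite (frontier S)" by (rule finite_subset) (use J in auto)
  show "closed S" "bounded S" unfolding J(2) using J(1) by (auto intro!: closed_UN)
qed

text \<open>The constituent intervals have positive length, so no point is isolated. This recovers a
  bubble from those of its points that avoid the finitely many boundary points.\<close>

lemma finite_interval_union_approx:
  assumes "finite_interval_union S" "x \<in> S" "finite B" "0 < e"
  obtains y where "y \<in> S" "y \<notin> B" "\<bar>y - x\<bar> < e"
proof -
  obtain a b where ab: "a < b" "x \<in> {a..b}" "{a..b} \<subseteq> S"
    using assms(1,2) unfolding finite_interval_union_def by fastforce
  have "max a (x - e) < min b (x + e)" using ab assms(4) by auto
  then have "infinite {max a (x - e) <..< min b (x + e)}" by (rule infinite_Ioo)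
  then obtain y where "y \<in> {max a (x - e) <..< min b (x + e)}" "y \<notin> B"
    using assms(3) by (meson finite_subset subsetI)
  then have "y \<in> {a..b}" "y \<notin> B" "\<bar>y - x\<bar> < e" by auto
  then show ?thesis using that[of y] ab(3) by blast
qed

text \<open>The boundary points cut the line into open intervals. Each is connected and free of
  boundary points, hence lies inside or outside every bubble. Disjoint interiors leave at most one
  bubble that contains it; if there is none, the interval gets label 0.\<close>

lemma tiling_exists:
  assumes E: "triple_bubble f V E" and ne: "\<exists>k\<in>labels. E k \<noteq> {}"
  shows "\<exists>q w. tiling E q w"
proof -
  define K where "K = labels"
  have K0: "0 \<notin> K" by (simp add: K_def)
  have fiu: "finite_interval_union (E k)" if "k \<in> K" for k
    using E that unfolding triple_bubble_def K_def by blast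
  have disj: "interior (E a) \<inter> interior (E b) = {}" if "a \<in> K" "b \<in> K" "a \<noteq> b" for a b
    using E that unfolding triple_bubble_def K_def by blast
  have finK: "finite K" by (simp add: K_def)
  note cl = finite_interval_union_frontier(2)[OF fiu]
  define B where "B = (\<Union>k\<in>K. frontier (E k))"
  have finB: "finite B" unfolding B_def using finite_interval_union_frontier(1)[OF fiu] finK by blast
  have inB: "x \<in> B" if "x \<in> frontier (E k)" "k \<in> K" for x k using that by (auto simp: B_def)
  \<comment> \<open>A nonempty set with empty frontier is the whole line, but bubbles are
    bounded.\<close>
  have "B \<noteq> {}"
  proof
    assume "B = {}"
    obtain k where k: "k \<in> K" "E k \<noteq> {}" using ne K_def by blast
    then have "frontier (E k) = {}" using \<open>B = {}\<close> inB by blast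
    then have "E k = UNIV" using frontier_eq_empty k by blast
    then show False
      using finite_interval_union_frontier(3)[OF fiu[OF k(1)]] not_bounded_UNIV by simp
  qed
  define l where "l = sorted_list_of_set B"
  define q where "q j = l ! j" for j
  define n where "n = length l - 1"
  have l: "sorted_wrt (<) l" "set l = B" "length l = Suc n"
    using finB \<open>B \<noteq> {}\<close> by (auto simp: l_def n_def card_gt_0_iff)
  have inc: "q i < q j" if "i < j" "j \<le> n" for i j
    unfolding q_def using l that by (auto intro: sorted_wrt_nth_less)
  have inc': "\<forall>j<n. q j < q (Suc j)" using inc by simp
  have mono: "q i \<le> q j" if "i \<le> j" "j \<le> n" for i j
    using inc[of i j] that by (cases "i = j") auto
  have Bq: "B = q ` {..n}"
    unfolding l(2)[symmetric] q_def by (auto simp: in_set_conv_nth l(3) less_Suc_eq_le)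
  define piece where "piece j = {q j <..< q (Suc j)}" for j
  have nB: "x \<notin> B" if "j < n" "x \<in> piece j" for j x
  proof
    assume "x \<in> B"
    then obtain i where "i \<le> n" "x = q i" using Bq by auto
    then show False
      using that mono[of i j] mono[of "Suc j" i] by (cases "i \<le> j") (auto simp: piece_def)
  qed
  have split: "S \<subseteq> E k \<or> S \<inter> E k = {}"
    if "connected S" "S \<inter> B = {}" "k \<in> K" for S k
  proof (rule ccontr)
    assume "\<not> (S \<subseteq> E k \<or> S \<inter> E k = {})"
    then have "S \<inter> frontier (E k) \<noteq> {}" using that by (intro connected_Int_frontier) auto
    then show False using that inB by blast
  qed
  have piece: "piece j \<subseteq> E k \<or> piece j \<inter> E k = {}" if "j < n" "k \<in> K" for j k
  proof (rule split)
    show "connected (piece j)" by (simp add: piece_def)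
    show "piece j \<inter> B = {}" using nB that by blast
  qed (rule that)
  have piece_ne: "piece j \<noteq> {}" if "j < n" for j
    using inc' that by (simp add: piece_def not_le)
  have "\<exists>c\<in>insert 0 K. \<forall>k\<in>K. c = k \<longleftrightarrow> piece j \<subseteq> E k" if j: "j < n" for j
  proof (cases "\<exists>c\<in>K. piece j \<subseteq> E c")
    case True
    then obtain c where c: "c \<in> K" "piece j \<subseteq> E c" by blast
    have op: "open (piece j)" by (simp add: piece_def)
    have "c = k" if k: "k \<in> K" "piece j \<subseteq> E k" for k
    proof (rule ccontr)
      assume "c \<noteq> k"
      moreover have "piece j \<subseteq> interior (E c)" "piece j \<subseteq> interior (E k)"
        by (rule interior_maximal[OF _ op], fact)+
      ultimately show False using disj[of c k] c(1) k(1) piece_ne[OF j] by blast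
    qed
    then have "\<forall>k\<in>K. c = k \<longleftrightarrow> piece j \<subseteq> E k" using c by blast
    then show ?thesis using c(1) by (intro bexI[of _ c]) simp_all
  next
    case False
    then have "\<forall>k\<in>K. 0 = k \<longleftrightarrow> piece j \<subseteq> E k" using K0 by blast
    then show ?thesis by (intro bexI[of _ 0]) simp_all
  qed
  then have "\<forall>j\<in>{..<n}. \<exists>c. c \<in> insert 0 K \<and> (\<forall>k\<in>K. c = k \<longleftrightarrow> piece j \<subseteq> E k)"
    unfolding Bex_def by simp
  from bchoice[OF this] obtain lab where
    lab0: "\<forall>j\<in>{..<n}. lab j \<in> insert 0 K \<and> (\<forall>k\<in>K. lab j = k \<longleftrightarrow> piece j \<subseteq> E k)" ..
  have lab_set: "lab j \<in> insert 0 K" if "j < n" for j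
    using lab0[rule_format, of j] that by simp
  have lab: "lab j = k \<longleftrightarrow> piece j \<subseteq> E k" if "j < n" "k \<in> K" for j k
    using lab0[rule_format, of j] that by simp
  define w where "w = map lab [0..<n]"
  have wn: "length w = n" and wj: "\<And>j. j < n \<Longrightarrow> w ! j = lab j" by (simp_all add: w_def)
  \<comment> \<open>The two unbounded rays contain no boundary point, so a bubble that meets one of
    them contains it and is unbounded.\<close>
  have outside: "q 0 \<le> x \<and> x \<le> q n" if k: "k \<in> K" and x: "x \<in> E k" for x k
  proof -
    obtain M where M: "\<forall>y\<in>E k. \<bar>y\<bar> \<le> M"
      using finite_interval_union_frontier(3)[OF fiu[OF k]] by (auto simp: bounded_real)
    have "{..<q 0} \<inter> B = {}" "{q n<..} \<inter> B = {}"
      using mono[of 0] mono[of _ n] unfolding Bq by (force simp: not_less)+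
    then have *: "{..<q 0} \<subseteq> E k \<or> {..<q 0} \<inter> E k = {}" "{q n<..} \<subseteq> E k \<or> {q n<..} \<inter> E k = {}"
      using split[OF _ _ k] connected_Iio connected_Ioi by blast+
    have "min (q 0) (- M) - 1 \<notin> E k" "max (q n) M + 1 \<notin> E k"
      using M by force+
    then have "{..<q 0} \<inter> E k = {}" "{q n<..} \<inter> E k = {}"
      using * by (auto simp: subset_iff)
    then show ?thesis using x by (auto simp: disjoint_iff not_less)
  qed
  have inside: "\<exists>j<n. x \<in> piece j" if "q 0 \<le> x \<and> x \<le> q n" "x \<notin> B" for x
  proof -
    have ne: "q j \<noteq> x" if "j \<le> n" for j using \<open>x \<notin> B\<close> Bq that by blast
    have "x < q n \<Longrightarrow> q 0 < x \<Longrightarrow> \<exists>j<n. q j < x \<and> x < q (Suc j)" if "m \<le> n" "x < q m" for m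
      using that
    proof (induction m)
      case (Suc m)
      show ?case
      proof (cases "x < q m")
        case True
        then show ?thesis using Suc by simp
      next
        case False
        then have "q m < x" using ne[of m] Suc.prems by simp
        then show ?thesis using Suc.prems by (intro exI[of _ m]) simp
      qed
    qed simp
    from this[of n] show ?thesis
      using that(1) ne[of n] ne[of 0] by (force simp: piece_def)
  qed
  have Ek: "E k = region q w k" if k: "k \<in> K" for k
  proof
    show "region q w k \<subseteq> E k"
    proof
      fix x assume "x \<in> region q w k"
      then obtain j where j: "j < n" "lab j = k" "x \<in> {q j .. q (Suc j)}"
        using wn wj by (auto simp: region_def)
      then have "closure (piece j) \<subseteq> E k" using lab k cl by (intro closure_minimal) auto
      moreover have "closure (piece j) = {q j .. q (Suc j)}"
        unfolding piece_def using inc' j by (intro closure_greaterThanLessThan) auto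
      ultimately show "x \<in> E k" using j by auto
    qed
    \<comment> \<open>Points other than boundary points lie in some open piece; boundary points
      follow by approximation, as the region is closed.\<close>
    show "E k \<subseteq> region q w k"
    proof
      fix x assume x: "x \<in> E k"
      have "closed (region q w k)" unfolding region_def by auto
      moreover have "x \<in> closure (region q w k)"
        unfolding closure_approachable
      proof (intro allI impI)
        fix e :: real assume "0 < e"
        from finite_interval_union_approx[OF fiu[OF k] x finB this]
        obtain y where y: "y \<in> E k" "y \<notin> B" "\<bar>y - x\<bar> < e" .
        then obtain j where j: "j < n" "y \<in> piece j"
          using outside[OF k] inside[of y] by blast
        then have "lab j = k" using piece[OF j(1) k] lab[OF j(1) k] y by blast
        then have "y \<in> region q w k" using j wn wj by (force simp: region_def piece_def)
        then show "\<exists>y\<in>region q w k. dist y x < e" using y by (auto simp: dist_real_def)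
      qed
      ultimately show "x \<in> region q w k" by simp
    qed
  qed
  \<comment> \<open>The point \<open>q (Suc j)\<close> is on the boundary of some bubble
    \<open>k\<close>, so one of its neighbouring pieces has label \<open>k\<close>. If the other had
    the same label, the point would be interior to that bubble.\<close>
  have adj: "lab j \<noteq> lab (Suc j)" if "Suc j < n" for j
  proof
    assume eq: "lab j = lab (Suc j)"
    have "q (Suc j) \<in> B" using Bq that by auto
    then obtain k where k: "k \<in> K" "q (Suc j) \<in> frontier (E k)" by (auto simp: B_def)
    then have "q (Suc j) \<in> E k" using cl[OF k(1)] frontier_subset_closed by blast
    then obtain i where i: "i < n" "lab i = k" "q i \<le> q (Suc j)" "q (Suc j) \<le> q (Suc i)"
      using Ek[OF k(1)] wn wj by (auto simp: region_def)
    have "i \<le> Suc j" using inc[of "Suc j" i] i by (meson less_imp_le linorder_not_le)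
    moreover have "j \<le> i" using inc[of "Suc i" "Suc j"] i that
      by (meson Suc_less_eq leD linorder_not_le less_imp_le)
    ultimately have "lab j = k" "lab (Suc j) = k" using i eq by (auto simp: le_Suc_eq)
    have "{q i .. q (Suc i)} \<subseteq> E k" if "i < n" "lab i = k" for i
      unfolding Ek[OF k(1)] region_def
      by (rule UN_upper[of i _ "\<lambda>j. {q j .. q (Suc j)}"]) (simp add: wn wj that)
    from this[of j] this[of "Suc j"]
    have "{q j .. q (Suc j)} \<union> {q (Suc j) .. q (Suc (Suc j))} \<subseteq> E k"
      using \<open>lab j = k\<close> \<open>lab (Suc j) = k\<close> that by simp
    moreover have "{q j <..< q (Suc (Suc j))} \<subseteq> {q j .. q (Suc j)} \<union> {q (Suc j) .. q (Suc (Suc j))}"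
      by auto
    ultimately have "{q j <..< q (Suc (Suc j))} \<subseteq> E k" by blast
    then have "{q j <..< q (Suc (Suc j))} \<subseteq> interior (E k)" by (rule interior_maximal) simp
    moreover have "q (Suc j) \<in> {q j <..< q (Suc (Suc j))}" using inc' that by auto
    ultimately show False using k(2) by (auto simp: frontier_def)
  qed
  have "w \<noteq> []"
  proof -
    obtain k where k: "k \<in> K" "E k \<noteq> {}" using ne K_def by blast
    then have "\<exists>j<length w. w ! j = k" using Ek by (auto simp: region_def)
    then show ?thesis by auto
  qed
  moreover have "set w \<subseteq> insert 0 K" using lab_set unfolding w_def by fastforce
  then have "set w \<subseteq> {0, 1, 2, 3}" by (simp add: K_def)
  ultimately have "tiling E q w"
    unfolding tiling_def K_def[symmetric] B_def[symmetric] using inc' adj Ek wn wj Bq by simp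
  then show ?thesis by blast
qed

section \<open>Triple bubbles in volume coordinates\<close>

lemma nondecreasing_intervals_Int:
  fixes q :: "nat \<Rightarrow> real"
  assumes mono: "\<forall>j<n. q j \<le> q (Suc j)" and "i < n" "j < n" "i \<noteq> j"
  shows "{q i .. q (Suc i)} \<inter> {q j .. q (Suc j)} \<subseteq> q ` {..n}"
proof -
  have *: "{q i .. q (Suc i)} \<inter> {q j .. q (Suc j)} \<subseteq> {q j}" if "i < j" "j < n" for i j
    using nondecreasing_upto[OF mono, of "Suc i" j] that by auto
  show ?thesis using *[of i j] *[of j i] assms by (cases "i < j") (auto 4 4)
qed

locale line_density =
  fixes f F :: "real \<Rightarrow> real"
  assumes f_pos: "0 < f x"
    and F_deriv: "(F has_real_derivative f x) (at x)"
    and F_surj: "surj F"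
begin

lemma F_strict: "x < y \<Longrightarrow> F x < F y"
  by (rule DERIV_pos_imp_increasing) (use f_pos F_deriv in blast)+

lemma F_less_iff: "F x < F y \<longleftrightarrow> x < y"
  using F_strict by (metis linorder_neqE_linordered_idom order_less_asym)

lemma F_le_iff: "F x \<le> F y \<longleftrightarrow> x \<le> y"
  using F_less_iff by (meson not_less)

lemma F_inj: "inj F"
  by (rule injI) (metis F_le_iff antisym order_refl)

lemma F_inv [simp]: "F (inv F t) = t"
  using F_surj by (rule surj_f_inv_f)

lemma inv_F [simp]: "inv F (F x) = x"
  using F_inj by (rule inv_f_f)

lemma has_integral_intervals:
  assumes mono: "\<forall>j<n. q j \<le> q (Suc j)" and A: "A \<subseteq> {..<n}"
  shows "(f has_integral (\<Sum>j\<in>A. F (q (Suc j)) - F (q j))) (\<Union>j\<in>A. {q j .. q (Suc j)})"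
proof (rule has_integral_UN)
  show "finite A" using A finite_subset by blast
  show "(f has_integral F (q (Suc j)) - F (q j)) {q j .. q (Suc j)}" if "j \<in> A" for j
    by (rule fundamental_theorem_of_calculus)
      (use that A mono F_deriv in
        \<open>auto simp: has_real_derivative_iff_has_vector_derivative[symmetric]
          intro: DERIV_subset\<close>)
  show "pairwise (\<lambda>i j. negligible ({q i .. q (Suc i)} \<inter> {q j .. q (Suc j)})) A"
  proof (rule pairwiseI)
    fix i j assume "i \<in> A" "j \<in> A" "i \<noteq> j"
    then have "{q i .. q (Suc i)} \<inter> {q j .. q (Suc j)} \<subseteq> q ` {..n}"
      using A by (intro nondecreasing_intervals_Int[OF mono]) auto
    then show "negligible ({q i .. q (Suc i)} \<inter> {q j .. q (Suc j)})"
      by (meson finite_atMost finite_imageI finite_subset negligible_finite)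
  qed
qed

lemma region_integral:
  assumes "\<forall>j<length w. q j \<le> q (Suc j)"
  shows "integral (region q w k) f = region_volume (F \<circ> q) w k"
  using has_integral_intervals[OF assms, of "{j. j < length w \<and> w ! j = k}"]
  unfolding region_def region_volume_def by (auto intro: integral_unique)

text \<open>Only an inequality, because \<open>p\<close> may repeat values and neighbouring labels
  may agree: empty pieces are dropped, coinciding points count once, and points interior to a bubble
  disappear.\<close>

lemma triple_bubble_exists:
  assumes mono: "\<forall>j<length w. p j \<le> p (Suc j)"
    and V: "\<forall>k\<in>labels. region_volume p w k = V k"
  obtains E where "triple_bubble f V E" "perimeter f E \<le> (\<Sum>j\<le>length w. f (inv F (p j)))"
proof -
  define n where "n = length w"
  define q where "q j = inv F (p j)" for j
  have Fq: "F (q j) = p j" for j by (simp add: q_def)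
  have qmono: "\<forall>j<n. q j \<le> q (Suc j)" using mono Fq F_le_iff by (simp add: n_def) metis
  define A where "A k = {j. j < n \<and> w ! j = k \<and> q j < q (Suc j)}" for k
  define E where "E k = (\<Union>j\<in>A k. {q j .. q (Suc j)})" for k
  have finA: "finite (A k)" for k by (simp add: A_def)
  have "finite_interval_union (E k)" for k
    unfolding finite_interval_union_def E_def
    by (intro exI[of _ "(\<lambda>j. (q j, q (Suc j))) ` A k"]) (auto simp: A_def)
  moreover have "integral (E k) f = V k" if "k \<in> labels" for k
  proof -
    have "(f has_integral (\<Sum>j\<in>A k. F (q (Suc j)) - F (q j))) (E k)"
      unfolding E_def by (rule has_integral_intervals[OF qmono]) (auto simp: A_def)
    moreover have "(\<Sum>j\<in>A k. F (q (Suc j)) - F (q j)) = region_volume p w k"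
      unfolding region_volume_def Fq
    proof (rule sum.mono_neutral_left)
      have "p j \<le> p (Suc j)" if "j < n" for j using mono that by (simp add: n_def)
      moreover have "q j < q (Suc j) \<longleftrightarrow> p j < p (Suc j)" for j
        using F_less_iff Fq by metis
      ultimately show "\<forall>j\<in>{j. j < length w \<and> w ! j = k} - A k. p (Suc j) - p j = 0"
        unfolding A_def n_def by fastforce
    qed (auto simp: A_def n_def)
    ultimately have "integral (E k) f = region_volume p w k" by (simp add: integral_unique)
    then show ?thesis using V that by metis
  qed
  moreover have "interior (E a) \<inter> interior (E b) = {}" if "a \<noteq> b" for a b
  proof -
    have "E a \<inter> E b \<subseteq> q ` {..n}"
    proof
      fix x assume "x \<in> E a \<inter> E b"
      then obtain i j where ij: "i < n" "j < n" "w ! i = a" "w ! j = b"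
        "x \<in> {q i .. q (Suc i)} \<inter> {q j .. q (Suc j)}" by (auto simp: E_def A_def)
      then have "i \<noteq> j" using \<open>a \<noteq> b\<close> by blast
      then show "x \<in> q ` {..n}" using nondecreasing_intervals_Int[OF qmono] ij by blast
    qed
    then have "finite (interior (E a) \<inter> interior (E b))"
      using interior_subset by (meson Int_mono finite_atMost finite_imageI finite_subset)
    moreover have "open (interior (E a) \<inter> interior (E b))" by blast
    ultimately show ?thesis using finite_imp_not_open by blast
  qed
  ultimately have "triple_bubble f V E" unfolding triple_bubble_def by blast
  moreover have "perimeter f E \<le> (\<Sum>j\<le>n. f (q j))"
  proof -
    have "frontier (E k) \<subseteq> q ` {..n}" for k
    proof -
      have "frontier (E k) \<subseteq> (\<Union>j\<in>A k. frontier {q j .. q (Suc j)})"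
        unfolding E_def by (rule frontier_finite_UN_subset[OF finA])
      also have "\<dots> \<subseteq> (\<Union>j\<in>A k. {q j, q (Suc j)})"
        by (intro UN_mono frontier_real_interval order_refl)
      also have "\<dots> \<subseteq> q ` {..n}" by (auto simp: A_def)
      finally show ?thesis .
    qed
    then have "perimeter f E \<le> sum f (q ` {..n})"
      unfolding perimeter_def using f_pos by (intro sum_mono2) (auto simp: less_imp_le)
    also have "\<dots> \<le> (\<Sum>j\<le>n. f (q j))"
      using sum_image_le[of "{..n}" f q] f_pos by (simp add: less_imp_le)
    finally show ?thesis .
  qed
  ultimately show ?thesis using that by (simp add: n_def q_def)
qed

lemma tiling_perimeter:
  assumes t: "tiling E q w"
  shows "perimeter f E = (\<Sum>j\<le>length w. f (q j))"
proof -
  have inc: "\<forall>j<length w. q j < q (Suc j)" using t by (simp add: tiling_def)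
  have "inj_on q {..length w}"
  proof (rule inj_onI)
    fix i j assume "i \<in> {..length w}" "j \<in> {..length w}" "q i = q j"
    then show "i = j"
      using increasing_upto[OF inc, of i j] increasing_upto[OF inc, of j i]
      by (cases i j rule: linorder_cases) auto
  qed
  moreover have "(\<Union>k\<in>labels. frontier (E k)) = q ` {..length w}"
    using t unfolding tiling_def by blast
  ultimately show ?thesis
    unfolding perimeter_def by (simp only: sum.reindex comp_def)
qed

lemma tiling_volume:
  assumes t: "tiling E q w" and E: "triple_bubble f V E" and k: "k \<in> labels"
  shows "region_volume (F \<circ> q) w k = V k"
proof -
  have inc: "\<forall>j<length w. q j \<le> q (Suc j)" using t by (simp add: tiling_def less_imp_le)
  have "integral (E k) f = V k" using E k unfolding triple_bubble_def by blast
  moreover have "E k = region q w k" using t k unfolding tiling_def by blast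
  ultimately show ?thesis using region_integral[OF inc] by metis
qed

end

definition pieces :: "(nat \<Rightarrow> real) \<Rightarrow> nat list \<Rightarrow> (nat \<times> real) list" where
  [simp]: "pieces p w = map (\<lambda>j. (w ! j, p (Suc j) - p j)) [0..<length w]"

lemma label_volume_map:
  "label_volume k (map h X) = (\<Sum>x\<leftarrow>X. if fst (h x) = k then snd (h x) else 0)"
  by (induction X) auto

lemma region_volume_pieces: "region_volume p w k = label_volume k (pieces p w)"
proof -
  have "label_volume k (pieces p w) = (\<Sum>j\<in>{0..<length w}. if w ! j = k then p (Suc j) - p j else 0)"
    by (simp add: label_volume_map interv_sum_list_conv_sum_set_nat cong: if_cong)
  also have "\<dots> = region_volume p w k"
    unfolding region_volume_def
    by (simp add: sum.If_cases Int_def)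
  finally show ?thesis by simp
qed

lemma ordered_type_cong:
  assumes "ordered_type V w" "\<forall>k\<in>labels. V k = V' k"
  shows "ordered_type V' w"
proof -
  obtain x y z W' where *: "distinct [x, y, z]" "{x, y, z} = labels" "V x \<le> V y" "V y \<le> V z"
    "W' \<in> {w, rev w}" "W' \<in> {[y, x, z], [z, x, y, z], [y, z, x, z], [z, y, x, y, z]}"
    using assms(1) unfolding ordered_type_def by blast
  then have "x \<in> labels" "y \<in> labels" "z \<in> labels" by blast+
  then have "V' x \<le> V' y" "V' y \<le> V' z" using assms(2) *(3,4) by metis+
  then show ?thesis using * unfolding ordered_type_def by blast
qed

lemma (in perimeter_profile) side_sum:
  "side s X = (\<Sum>j\<le>length X. g (s + total_length (take j X)))"
proof (induction X arbitrary: s)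
  case (Cons x X)
  show ?case
    unfolding side.simps Cons length_Cons sum.atMost_Suc_shift by (simp add: add.assoc)
qed simp

locale convex_line_density = line_density + perimeter_profile "\<lambda>t. f (inv F t)"
begin

text \<open>Any row of labelled lengths, started at any coordinate, describes a competitor, with
  \<open>side\<close> as an upper bound for its perimeter.\<close>

lemma side_ge_perimeter:
  assumes min: "perimeter_minimizing f V E"
    and X: "\<forall>x\<in>set X. 0 \<le> snd x" "\<forall>k\<in>labels. label_volume k X = V k"
  shows "perimeter f E \<le> side s X"
proof -
  define p where "p j = s + total_length (take j X)" for j
  define w where "w = map fst X"
  have step: "p (Suc j) = p j + snd (X ! j)" if "j < length X" for j
    using that by (simp add: p_def take_Suc_conv_app_nth)
  have "\<forall>j<length w. p j \<le> p (Suc j)" using X(1) step by (simp add: w_def)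
  moreover have "pieces p w = X"
    by (rule nth_equalityI) (simp_all add: w_def step)
  then have "\<forall>k\<in>labels. region_volume p w k = V k"
    using X(2) by (simp only: region_volume_pieces simp_thms)
  ultimately obtain E' where E': "triple_bubble f V E'"
    "perimeter f E' \<le> (\<Sum>j\<le>length w. f (inv F (p j)))"
    by (rule triple_bubble_exists)
  then have "perimeter f E \<le> perimeter f E'" using min by (auto simp: perimeter_minimizing_def)
  then show ?thesis using E'(2) by (simp add: side_sum p_def w_def)
qed

lemma minimizing_ordered_type:
  assumes min: "perimeter_minimizing f V E" and pos: "\<forall>k\<in>labels. 0 < V k" and t: "tiling E q w"
  shows "ordered_type V w"
proof -
  define p where "p = F \<circ> q"
  define n where "n = length w"
  define X where "X = pieces p w"
  have E: "triple_bubble f V E" using min by (simp add: perimeter_minimizing_def)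
  have inc: "p j < p (Suc j)" if "j < n" for j
    using t F_strict that by (simp add: tiling_def p_def n_def)
  have lenX: "length X = n" and fstX: "map fst X = w"
    by (simp_all add: X_def n_def comp_def map_nth)
  have Xj: "X ! j = (w ! j, p (Suc j) - p j)" if "j < n" for j
    using that by (simp add: X_def n_def)
  have Xpos: "\<forall>x\<in>set X. 0 < snd x"
    using inc by (auto simp: X_def n_def)
  have Xvol: "label_volume k X = V k" if "k \<in> labels" for k
    using tiling_volume[OF t E that] by (simp only: region_volume_pieces X_def p_def)
  have psum: "p 0 + total_length (take j X) = p j" if "j \<le> n" for j
    using that
  proof (induction j)
    case (Suc j)
    then show ?case using lenX Xj[of j] by (simp add: take_Suc_conv_app_nth)
  qed simp
  have Xperim: "perimeter f E = side (p 0) X"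
    unfolding tiling_perimeter[OF t] side_sum lenX n_def[symmetric]
    by (rule sum.cong) (simp_all add: psum, simp add: p_def)
  have le: "side (p 0) X \<le> side s Y"
    if "\<forall>x\<in>set Y. 0 \<le> snd x" "\<forall>k\<in>labels. label_volume k Y = V k" for s Y
    using side_ge_perimeter[OF min that] Xperim by simp
  have Xvol': "\<forall>k\<in>labels. label_volume k X = V k" "\<forall>k\<in>labels. label_volume k (rev X) = V k"
    using Xvol by simp_all
  have Xnn: "\<forall>x\<in>set X. 0 \<le> snd x" "\<forall>x\<in>set (rev X). 0 \<le> snd x"
    using Xpos by (simp_all add: less_imp_le)
  \<comment> \<open>A row strictly on one side of the origin is improved by sliding it up to the
    origin. Hence some piece contains the origin and can serve as the centre.\<close>
  have "p 0 \<le> 0"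
  proof (rule ccontr)
    assume "\<not> p 0 \<le> 0"
    then have "side 0 X < side (p 0) X" using Xnn by (intro side_strict) auto
    then show False using le[OF Xnn(1) Xvol'(1), of 0] by simp
  qed
  moreover have "0 \<le> p n"
  proof (rule ccontr)
    assume "\<not> 0 \<le> p n"
    then have "side 0 (rev X) < side (- p n) (rev X)" using Xnn by (intro side_strict) auto
    moreover have "side (- p n) (rev X) = side (p 0) X"
    proof -
      have "p n - total_length X = p 0" using psum[of n] lenX by simp
      then show ?thesis by (simp add: side_reverse)
    qed
    ultimately show False using le[OF Xnn(2) Xvol'(2), of 0] by simp
  qed
  moreover have "0 < n" using t by (simp add: tiling_def n_def)
  ultimately have "\<exists>j<n. p j \<le> 0 \<and> 0 \<le> p (Suc j)"
  proof -
    have "0 < m \<Longrightarrow> m \<le> n \<Longrightarrow> 0 \<le> p m \<Longrightarrow> \<exists>j<n. p j \<le> 0 \<and> 0 \<le> p (Suc j)" for m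
    proof (induction m)
      case (Suc m)
      show ?case
      proof (cases "0 < m \<and> 0 \<le> p m")
        case True
        then show ?thesis using Suc by simp
      next
        case False
        then have "p m \<le> 0" using \<open>p 0 \<le> 0\<close> by (cases "m = 0") auto
        then show ?thesis using Suc.prems by (intro exI[of _ m]) simp
      qed
    qed simp
    then show ?thesis using \<open>0 < n\<close> \<open>0 \<le> p n\<close> by blast
  qed
  then obtain j where j: "j < n" "p j \<le> 0" "0 \<le> p (Suc j)" by blast
  define L where "L = rev (take j X)"
  define R where "R = drop (Suc j) X"
  define u where "u = - p j"
  define v where "v = p (Suc j)"
  have X: "X = rev L @ (w ! j, u + v) # R"
    using id_take_nth_drop[of j X] j lenX Xj[of j] by (simp add: L_def R_def u_def v_def)
  have "total_length L = total_length (take j X)"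
    by (simp add: L_def rev_map[symmetric] sum_list_rev)
  then have start: "- u - total_length L = p 0" using psum[of j] j by (simp add: u_def)
  have cost: "side (p 0) X = side u L + side v R"
    unfolding start[symmetric] by (subst X) (rule side_centre)
  have vol: "configuration_volume k (w ! j) u L v R = label_volume k X" for k
    by (subst X) (simp add: configuration_volume_def)
  have "optimal (w ! j) u L v R"
    unfolding optimal_def
  proof (intro conjI allI impI)
    show "0 \<le> u" "0 \<le> v" "0 < u + v" using j inc[of j] by (auto simp: u_def v_def)
    show "\<forall>p\<in>set L. 0 < snd p" "\<forall>p\<in>set R. 0 < snd p"
      using Xpos X by (metis Un_iff set_append set_rev list.set_intros(2))+
    show "\<forall>k\<in>labels. 0 < configuration_volume k (w ! j) u L v R"
      unfolding vol using pos Xvol by metis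
  next
    fix a' u' L' v' R'
    assume *: "0 \<le> u' \<and> 0 \<le> v' \<and> (\<forall>p\<in>set L'. 0 \<le> snd p) \<and> (\<forall>p\<in>set R'. 0 \<le> snd p) \<and>
      (\<forall>k\<in>labels. configuration_volume k a' u' L' v' R' = configuration_volume k (w ! j) u L v R)"
    \<comment> \<open>The two-sided competitor is flattened into a row, to which \<open>le\<close>
      applies.\<close>
    let ?Y = "rev L' @ (a', u' + v') # R'"
    have "label_volume k ?Y = configuration_volume k a' u' L' v' R'" for k
      by (simp add: configuration_volume_def)
    then have "\<forall>k\<in>labels. label_volume k ?Y = V k" using * vol Xvol by metis
    moreover have "\<forall>x\<in>set ?Y. 0 \<le> snd x" using * by auto
    ultimately have "side (p 0) X \<le> side (- u' - total_length L') ?Y" by (intro le) auto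
    then show "side u L + side v R \<le> side u' L' + side v' R'" by (simp only: cost side_centre)
  qed
  from optimal_word[OF this refl]
  have "ordered_type (\<lambda>k. label_volume k X) (rev (map fst L) @ w ! j # map fst R)"
    by (simp only: vol)
  moreover have "rev (map fst L) @ w ! j # map fst R = w"
    using arg_cong[OF X, of "map fst"] fstX by (simp add: rev_map)
  ultimately have "ordered_type (\<lambda>k. label_volume k X) w" by simp
  then show ?thesis using ordered_type_cong Xvol by blast
qed

end

section \<open>Reflection and relabelling\<close>

lemma uminus_atLeastAtMost: "uminus ` {a..b :: real} = {- b .. - a}"
  by auto

lemma frontier_uminus: "frontier (uminus ` S) = uminus ` frontier S" for S :: "real set"
proof -
  have "closure (uminus ` S) = uminus ` closure S"
    by (rule closure_injective_linear_image[symmetric]) (simp_all add: linear_uminus)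
  then show ?thesis by (simp add: frontier_def interior_negations image_set_diff)
qed

lemma tilingD:
  assumes "tiling E q w"
  shows "set w \<subseteq> {0, 1, 2, 3}" "w \<noteq> []" "\<And>j. j < length w \<Longrightarrow> q j < q (Suc j)"
    "\<And>j. Suc j < length w \<Longrightarrow> w ! j \<noteq> w ! Suc j"
    "\<And>k. k \<in> labels \<Longrightarrow> E k = region q w k"
    "(\<Union>k\<in>labels. frontier (E k)) = q ` {..length w}"
  using assms unfolding tiling_def by blast+

lemma tiling_reflect:
  assumes t: "tiling E q w"
  shows "tiling (reflect E) (\<lambda>j. - q (length w - j)) (rev w)"
proof -
  let ?n = "length w" and ?q = "\<lambda>j. - q (length w - j)"
  note t' = tilingD[OF t]
  have region: "uminus ` region q w k = region ?q (rev w) k" for k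
  proof -
    have "{j. j < ?n \<and> rev w ! j = k} = (\<lambda>j. ?n - Suc j) ` {j. j < ?n \<and> w ! j = k}"
    proof (intro set_eqI iffI)
      fix j assume "j \<in> {j. j < ?n \<and> rev w ! j = k}"
      then show "j \<in> (\<lambda>j. ?n - Suc j) ` {j. j < ?n \<and> w ! j = k}"
        by (intro image_eqI[of _ _ "?n - Suc j"]) (auto simp: rev_nth)
    qed (auto simp: rev_nth)
    then have "region ?q (rev w) k
        = (\<Union>j\<in>{j. j < ?n \<and> w ! j = k}. {?q (?n - Suc j) .. ?q (Suc (?n - Suc j))})"
      unfolding region_def by simp
    also have "\<dots> = (\<Union>j\<in>{j. j < ?n \<and> w ! j = k}. uminus ` {q j .. q (Suc j)})"
      by (intro SUP_cong refl) (auto simp: uminus_atLeastAtMost Suc_diff_Suc)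
    also have "\<dots> = uminus ` region q w k" by (simp add: region_def image_UN)
    finally show ?thesis by simp
  qed
  have fr: "(\<Union>k\<in>labels. frontier (reflect E k)) = ?q ` {..?n}"
  proof -
    have "(\<Union>k\<in>labels. frontier (reflect E k)) = uminus ` (\<Union>k\<in>labels. frontier (E k))"
      unfolding reflect_def frontier_uminus image_UN ..
    also have "\<dots> = uminus ` q ` {..?n}" by (simp only: t'(6))
    also have "\<dots> = ?q ` {..?n}"
    proof (intro set_eqI iffI)
      fix x assume "x \<in> uminus ` q ` {..?n}"
      then obtain j where "j \<le> ?n" "x = - q j" by auto
      then show "x \<in> ?q ` {..?n}" by (intro image_eqI[of _ _ "?n - j"]) auto
    qed auto
    finally show ?thesis .
  qed
  show ?thesis
    unfolding tiling_def
  proof (intro conjI allI impI ballI)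
    show "set (rev w) \<subseteq> {0, 1, 2, 3}" "rev w \<noteq> []" using t'(1,2) by simp_all
    show "(\<Union>k\<in>labels. frontier (reflect E k)) = ?q ` {..length (rev w)}" using fr by simp
  next
    fix j assume j: "j < length (rev w)"
    then have "?n - j = Suc (?n - Suc j)" "?n - Suc j < ?n" by auto
    then show "?q j < ?q (Suc j)" using t'(3) by simp
  next
    fix j assume j: "Suc j < length (rev w)"
    then have "Suc (?n - Suc (Suc j)) < ?n" "?n - Suc j = Suc (?n - Suc (Suc j))" by auto
    then have "w ! (?n - Suc (Suc j)) \<noteq> w ! (?n - Suc j)" using t'(4) by metis
    then show "rev w ! j \<noteq> rev w ! Suc j" using j by (simp add: rev_nth)
  next
    fix k assume "k \<in> labels"
    then have "E k = region q w k" by (rule t'(5))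
    then show "reflect E k = region ?q (rev w) k" by (simp add: reflect_def region)
  qed
qed

text \<open>Bubble \<open>k\<close> of \<open>E \<circ> \<sigma>\<close> is bubble
  \<open>\<sigma> k\<close> of \<open>E\<close>, so its word is obtained from that of
  \<open>E\<close> by undoing \<open>\<sigma>\<close>; hence \<open>map \<sigma> w\<close> in the
  hypothesis.\<close>

lemma tiling_permute:
  assumes t: "tiling E q (map \<sigma> w)" and \<sigma>: "\<sigma> permutes labels" and w: "set w \<subseteq> labels"
  shows "tiling (E \<circ> \<sigma>) q w"
proof -
  note t' = tilingD[OF t]
  have inj: "inj \<sigma>" using permutes_inj[OF \<sigma>] .
  have region: "region q (map \<sigma> w) (\<sigma> k) = region q w k" for k
    unfolding region_def using inj by (intro SUP_cong) (auto simp: inj_eq)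
  have "(\<Union>k\<in>labels. frontier ((E \<circ> \<sigma>) k)) = (\<Union>k\<in>\<sigma> ` labels. frontier (E k))"
    unfolding image_image comp_def ..
  then have fr: "(\<Union>k\<in>labels. frontier ((E \<circ> \<sigma>) k)) = (\<Union>k\<in>labels. frontier (E k))"
    unfolding permutes_image[OF \<sigma>] .
  show ?thesis
    unfolding tiling_def fr
  proof (intro conjI allI impI ballI)
    show "set w \<subseteq> {0, 1, 2, 3}" using w by blast
    show "w \<noteq> []" using t'(2) by simp
    show "(\<Union>k\<in>labels. frontier (E k)) = q ` {..length w}" using t'(6) by (simp only: length_map)
    show "q j < q (Suc j)" if "j < length w" for j using t'(3) that by simp
    show "w ! j \<noteq> w ! Suc j" if "Suc j < length w" for j using t'(4)[of j] that by auto
    show "(E \<circ> \<sigma>) k = region q w k" if "k \<in> labels" for k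
    proof -
      have "\<sigma> k \<in> labels" using permutes_in_image[OF \<sigma>, of k] that by (simp only: simp_thms)
      then have "E (\<sigma> k) = region q (map \<sigma> w) (\<sigma> k)" by (rule t'(5))
      then show ?thesis by (simp add: region)
    qed
  qed
qed

lemma permute_minimizing:
  assumes min: "perimeter_minimizing f V E" and \<sigma>: "\<sigma> permutes labels"
    and V: "\<forall>k\<in>labels. V (\<sigma> k) = V k"
  shows "perimeter_minimizing f V (E \<circ> \<sigma>)"
proof -
  have in_labels: "\<sigma> k \<in> labels" if "k \<in> labels" for k
    using permutes_in_image[OF \<sigma>, of k] that by (simp only: simp_thms)
  have inj: "\<sigma> a \<noteq> \<sigma> b" if "a \<noteq> b" for a b using permutes_inj[OF \<sigma>] that by (meson injD)
  have E: "triple_bubble f V E" using min by (simp add: perimeter_minimizing_def)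
  then have "triple_bubble f V (E \<circ> \<sigma>)"
    unfolding triple_bubble_def comp_def using in_labels inj V by metis
  moreover have "perimeter f (E \<circ> \<sigma>) = perimeter f E"
  proof -
    have "(\<Union>k\<in>labels. frontier ((E \<circ> \<sigma>) k)) = (\<Union>k\<in>\<sigma> ` labels. frontier (E k))"
      unfolding image_image comp_def ..
    then show ?thesis unfolding perimeter_def permutes_image[OF \<sigma>] by simp
  qed
  ultimately show ?thesis using min by (simp add: perimeter_minimizing_def)
qed

text \<open>The tiling supplies integrability of \<open>f\<close> on each bubble, as required by the
  substitution of -x for x.\<close>

lemma (in line_density) reflect_minimizing:
  assumes sym: "symmetric_density f" and min: "perimeter_minimizing f V E" and t: "tiling E q w"
  shows "perimeter_minimizing f V (reflect E)"
proof -
  have E: "triple_bubble f V E" using min by (simp add: perimeter_minimizing_def)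
  have inc: "\<forall>j<length w. q j \<le> q (Suc j)" using t by (simp add: tiling_def less_imp_le)
  have fsym: "f (- x) = f x" for x using sym by (simp add: symmetric_density_def)
  have "finite_interval_union (reflect E k)" if k: "k \<in> labels" for k
  proof -
    have "finite_interval_union (E k)" using E k unfolding triple_bubble_def by blast
    then obtain J where J: "finite J" "\<forall>(a, b)\<in>J. a < b" "E k = (\<Union>(a, b)\<in>J. {a..b})"
      unfolding finite_interval_union_def by blast
    show ?thesis
      unfolding finite_interval_union_def reflect_def J(3)
      by (intro exI[of _ "(\<lambda>(a, b). (- b, - a)) ` J"])
        (use J(1,2) in \<open>auto simp: image_UN case_prod_unfold uminus_atLeastAtMost\<close>)
  qed
  note fiu = this
  moreover have "integral (reflect E k) f = V k" if k: "k \<in> labels" for k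
  proof -
    have Ek: "E k = region q w k" using t k unfolding tiling_def by blast
    have "f integrable_on E k"
      unfolding Ek region_def by (rule has_integral_integrable, rule has_integral_intervals[OF inc]) auto
    then have "f absolutely_integrable_on E k"
      using f_pos by (intro nonnegative_absolutely_integrable_1) (auto simp: less_imp_le)
    moreover have "uminus ` E k \<in> sets lebesgue"
      using finite_interval_union_frontier(2)[OF fiu[OF k]] by (simp add: reflect_def lebesgue_closedin)
    ultimately have "integral (uminus ` E k) (\<lambda>x. f (- x)) = integral (E k) f"
      using has_absolute_integral_reflect_real[of "uminus ` E k" "E k" f "integral (E k) f"]
      by (auto simp: image_image)
    moreover have "integral (E k) f = V k" using E k unfolding triple_bubble_def by blast
    ultimately show ?thesis by (simp add: reflect_def fsym)
  qed
  moreover have "interior (reflect E a) \<inter> interior (reflect E b) = {}"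
    if "a \<in> labels" "b \<in> labels" "a \<noteq> b" for a b
  proof -
    have "interior (E a) \<inter> interior (E b) = {}" using E that unfolding triple_bubble_def by blast
    then show ?thesis by (auto simp: reflect_def interior_negations)
  qed
  ultimately have "triple_bubble f V (reflect E)" unfolding triple_bubble_def by blast
  moreover have "perimeter f (reflect E) = perimeter f E"
  proof -
    have "(\<Union>k\<in>labels. frontier (reflect E k)) = uminus ` (\<Union>k\<in>labels. frontier (E k))"
      unfolding reflect_def frontier_uminus image_UN ..
    then show ?thesis unfolding perimeter_def by (simp only:) (simp add: sum.reindex fsym)
  qed
  ultimately show ?thesis using min by (simp add: perimeter_minimizing_def)
qed

text \<open>The volumes are sorted in the order 1, 2, 3 and also in the order \<open>x\<close>,
  \<open>y\<close>, \<open>z\<close>, so the two lists agree entry by entry, and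
  \<open>\<sigma>\<close> only permutes labels of equal volumes.\<close>

lemma ordered_type_four_types:
  assumes o: "ordered_type V w" and V: "V 1 \<le> V 2" "V 2 \<le> V 3"
  obtains \<sigma> w' where "\<sigma> permutes labels" "\<forall>k\<in>labels. V (\<sigma> k) = V k" "w' \<in> four_types"
    "w = map \<sigma> w' \<or> rev w = map \<sigma> w'"
proof -
  obtain x y z W where xyz: "distinct [x, y, z]" "{x, y, z} = labels" "V x \<le> V y" "V y \<le> V z"
    and W: "W = w \<or> W = rev w"
      "W = [y, x, z] \<or> W = [z, x, y, z] \<or> W = [y, z, x, z] \<or> W = [z, y, x, y, z]"
    using o unfolding ordered_type_def by blast
  define \<sigma> where "\<sigma> = id(1 := x, 2 := y, 3 := z)"
  have \<sigma>: "\<sigma> 1 = x" "\<sigma> 2 = y" "\<sigma> 3 = z" "\<And>k. k \<notin> labels \<Longrightarrow> \<sigma> k = k"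
    by (auto simp: \<sigma>_def)
  have "\<sigma> ` labels = labels" using xyz(2) \<sigma>(1-3) by simp
  moreover have "inj_on \<sigma> labels"
    using \<open>\<sigma> ` labels = labels\<close> by (intro eq_card_imp_inj_on) simp_all
  ultimately have perm: "\<sigma> permutes labels"
    using \<sigma>(4) by (intro bij_imp_permutes) (auto simp: bij_betw_def)
  have "x \<in> labels" "y \<in> labels" "z \<in> labels" using xyz(2) by blast+
  then have "V x = V 1 \<and> V y = V 2 \<and> V z = V 3"
    using xyz V by (elim insertE emptyE; simp)
  then have "\<forall>k\<in>labels. V (\<sigma> k) = V k" using \<sigma>(1-3) by simp
  moreover define w' where "w' = (if W = [y, x, z] then [2, 1, 3] else if W = [z, x, y, z] then [3, 1, 2, 3]
    else if W = [y, z, x, z] then [2, 3, 1, 3] else [3, 2, 1, 2, 3::nat])"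
  have "w' \<in> four_types" by (simp add: w'_def four_types_def)
  moreover have "W = map \<sigma> w'" using W(2) \<sigma>(1-3) by (auto simp: w'_def)
  then have "w = map \<sigma> w' \<or> rev w = map \<sigma> w'" using W(1) by auto
  ultimately show ?thesis using that perm by blast
qed

lemma four_types_labels: "w \<in> four_types \<Longrightarrow> set w \<subseteq> labels"
  by (auto simp: four_types_def)

lemma (in convex_line_density) minimizing_tiling:
  assumes min: "perimeter_minimizing f V E" and V: "0 < V 1" "V 1 \<le> V 2" "V 2 \<le> V 3"
  obtains \<sigma> w q where "\<sigma> permutes labels" "\<forall>k\<in>labels. V (\<sigma> k) = V k" "w \<in> four_types"
    "tiling (E \<circ> \<sigma>) q w \<or> tiling (reflect (E \<circ> \<sigma>)) q w"
proof -
  have E: "triple_bubble f V E" using min by (simp add: perimeter_minimizing_def)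
  have pos: "\<forall>k\<in>labels. 0 < V k" using V by simp
  have "integral (E 1) f = V 1" using E by (simp add: triple_bubble_def)
  then have "E 1 \<noteq> {}" using V(1) by auto
  then have "\<exists>q w. tiling E q w" by (intro tiling_exists[OF E] bexI[of _ 1]) simp_all
  then obtain q w where t: "tiling E q w" by blast
  from minimizing_ordered_type[OF min pos t] V(2,3) obtain \<sigma> w' where
    \<sigma>: "\<sigma> permutes labels" "\<forall>k\<in>labels. V (\<sigma> k) = V k" and w': "w' \<in> four_types"
    and w: "w = map \<sigma> w' \<or> rev w = map \<sigma> w'"
    by (rule ordered_type_four_types)
  have lab: "set w' \<subseteq> labels" using four_types_labels[OF w'] .
  have "reflect E \<circ> \<sigma> = reflect (E \<circ> \<sigma>)" by (simp add: reflect_def fun_eq_iff)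
  then have "\<exists>q. tiling (E \<circ> \<sigma>) q w' \<or> tiling (reflect (E \<circ> \<sigma>)) q w'"
    using w tiling_permute[OF _ \<sigma>(1) lab] t tiling_reflect[OF t] by metis
  then show ?thesis using that \<sigma> w' by blast
qed

section \<open>Log-convex densities\<close>

lemma primitive_exists:
  fixes f :: "real \<Rightarrow> real"
  assumes "continuous_on UNIV f"
  obtains F where "\<And>x. (F has_real_derivative f x) (at x)" "F 0 = 0"
proof -
  have "\<exists>G. \<forall>x::real. - \<infinity> < ereal x \<longrightarrow> ereal x < \<infinity> \<longrightarrow> (G has_vector_derivative f x) (at x)"
    by (rule einterval_antiderivative) (use assms in \<open>auto simp: continuous_on_eq_continuous_at\<close>)
  then obtain G where "\<And>x. (G has_real_derivative f x) (at x)"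
    by (auto simp: has_real_derivative_iff_has_vector_derivative)
  then have "((\<lambda>x. G x - G 0) has_real_derivative f x) (at x)" for x
    by (auto intro!: derivative_eq_intros)
  then show ?thesis using that[of "\<lambda>x. G x - G 0"] by simp
qed

text \<open>As ln f may have corners, convexity in the volume coordinate is proved by giving the
  profile a supporting line at every positive volume. It comes from comparing \<open>f\<close> with
  exponentials, which can be integrated explicitly.\<close>

lemma convex_line_density_exists:
  assumes pos: "positive_density f" and sym: "symmetric_density f" and lc: "log_convex f"
    and min0: "\<And>x. x \<noteq> 0 \<Longrightarrow> f 0 < f x"
  obtains F where "convex_line_density f F" "F 0 = 0"
proof -
  have fpos: "0 < f x" for x using pos by (simp add: positive_density_def)
  have fsym: "f (- x) = f x" for x using sym by (simp add: symmetric_density_def)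
  define \<phi> where "\<phi> x = ln (f x)" for x
  have f_exp: "f x = exp (\<phi> x)" for x using fpos by (simp add: \<phi>_def)
  have conv: "convex_on UNIV \<phi>" using lc by (simp add: log_convex_def \<phi>_def[abs_def])
  then have "continuous_on UNIV \<phi>" by (intro convex_on_continuous) auto
  then have "continuous_on UNIV f" unfolding f_exp[abs_def] by (intro continuous_intros)
  then obtain F where F_deriv: "\<And>x. (F has_real_derivative f x) (at x)" and F0: "F 0 = 0"
    by (rule primitive_exists) (rule that)
  have f_ge: "f 0 \<le> f x" for x using min0[of x] by (cases "x = 0") auto
  have chord: "(y - x) * \<phi> s \<le> (y - s) * \<phi> x + (s - x) * \<phi> y" if "x \<le> s" "s \<le> y" for x s y
  proof (cases "x = y")
    case False
    then have xy: "x < y" using that by simp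
    define \<theta> where "\<theta> = (s - x) / (y - x)"
    have "\<phi> ((1 - \<theta>) *\<^sub>R x + \<theta> *\<^sub>R y) \<le> (1 - \<theta>) * \<phi> x + \<theta> * \<phi> y"
      by (rule convex_onD[OF conv]) (use that xy in \<open>auto simp: \<theta>_def\<close>)
    moreover have \<theta>: "(y - x) * \<theta> = s - x" using xy by (simp add: \<theta>_def)
    then have "(1 - \<theta>) *\<^sub>R x + \<theta> *\<^sub>R y = s" by (simp add: algebra_simps)
    ultimately have "(y - x) * \<phi> s \<le> (y - x) * ((1 - \<theta>) * \<phi> x + \<theta> * \<phi> y)"
      using xy by (intro mult_left_mono) simp_all
    also have "\<dots> = ((y - x) - (y - x) * \<theta>) * \<phi> x + ((y - x) * \<theta>) * \<phi> y"
      by (simp add: algebra_simps)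
    finally show ?thesis unfolding \<theta> by simp
  qed (use that in simp)
  have f_strict: "f x < f y" if "0 \<le> x" "x < y" for x y
  proof -
    have "\<phi> 0 < \<phi> y" using min0[of y] that fpos by (simp add: \<phi>_def)
    moreover have "y * \<phi> x \<le> (y - x) * \<phi> 0 + x * \<phi> y" using chord[of 0 x y] that by simp
    ultimately have "y * \<phi> x < (y - x) * \<phi> y + x * \<phi> y"
      using that by (smt (verit) mult_strict_left_mono)
    then have "y * \<phi> x < y * \<phi> y" by (simp add: algebra_simps)
    then have "\<phi> x < \<phi> y" using that by simp
    then show ?thesis by (simp add: f_exp)
  qed
  have F_odd: "F (- x) = - F x" for x
  proof -
    have "((\<lambda>x. F x + F (- x)) has_real_derivative 0) (at x)" for x
      using DERIV_add[OF F_deriv[of x] DERIV_chain2[OF F_deriv[of "- x"] DERIV_minus[OF DERIV_ident]]]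
      by (simp add: fsym)
    then have "F x + F (- x) = F 0 + F (- 0)" by (intro DERIV_isconst_all) blast
    then show ?thesis by (simp add: F0)
  qed
  \<comment> \<open>This linear growth, due to the minimum of \<open>f\<close> at 0, makes
    \<open>F\<close> surjective.\<close>
  have F_ge: "f 0 * x \<le> F x" if "0 \<le> x" for x
  proof -
    have "F 0 - f 0 * 0 \<le> F x - f 0 * x"
    proof (rule DERIV_nonneg_imp_nondecreasing[OF that])
      fix s show "\<exists>y. ((\<lambda>x. F x - f 0 * x) has_real_derivative y) (at s) \<and> 0 \<le> y"
        by (intro exI[of _ "f s - f 0"] conjI) (auto intro!: derivative_eq_intros F_deriv simp: f_ge)
    qed
    then show ?thesis by (simp add: F0)
  qed
  have "surj F"
    unfolding surj_def
  proof
    fix t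
    define M where "M = \<bar>t\<bar> / f 0"
    have M: "0 \<le> M" "\<bar>t\<bar> \<le> F M" using fpos[of 0] F_ge[of M] by (auto simp: M_def)
    then have "F (- M) \<le> t" "t \<le> F M" by (auto simp: F_odd)
    moreover have "\<forall>x. - M \<le> x \<and> x \<le> M \<longrightarrow> isCont F x" using F_deriv DERIV_isCont by blast
    ultimately have "\<exists>x. - M \<le> x \<and> x \<le> M \<and> F x = t" using M by (intro IVT) auto
    then show "\<exists>x. t = F x" by blast
  qed
  interpret line_density f F
    by unfold_locales (use fpos F_deriv \<open>surj F\<close> in auto)
  have inv0: "inv F 0 = 0" using inv_F[of 0] F0 by simp
  have inv_odd: "inv F (- t) = - inv F t" for t
    using inv_F[of "- inv F t"] by (simp add: F_odd)
  have inv_less: "inv F s < inv F t \<longleftrightarrow> s < t" for s t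
    using F_less_iff[of "inv F s" "inv F t"] by simp
  text \<open>A supporting line of ln f at x0 yields one, of the same slope, of the density as a
    function of the volume.\<close>
  have support: "\<exists>m. \<forall>t. f (inv F t) \<ge> f x0 + m * (t - F x0)" if x0: "0 < x0" for x0
  proof -
    obtain m where m: "\<And>y. \<phi> x0 + m * (y - x0) \<le> \<phi> y"
      using convex_le_Inf_differential[OF conv, of x0] by auto
    have "\<phi> 0 < \<phi> x0" using min0[of x0] x0 fpos by (simp add: \<phi>_def)
    with m[of 0] have "0 < m * x0" by simp
    then have m_pos: "0 < m" using x0 by (simp add: zero_less_mult_iff)
    have lower: "f x0 * exp (m * (y - x0)) \<le> f y" for y
      using m[of y] by (simp add: f_exp exp_add[symmetric])
    have "f y \<ge> f x0 + m * (F y - F x0)" for y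
    proof (cases "x0 \<le> y")
      case True
      \<comment> \<open>The chord of \<open>\<phi>\<close> from \<open>s\<close> to \<open>y\<close>
        is at least as steep as the one from \<open>x0\<close> to \<open>y\<close>, whose slope is
        at least \<open>m\<close>. So on [x0, y] the density lies below an exponential through its
        value at \<open>y\<close>, and integrating that bounds \<open>F y - F x0\<close> from
        above.\<close>
      have upper: "f s \<le> f y * exp (m * (s - y))" if "x0 \<le> s" "s \<le> y" for s
      proof -
        have "\<phi> s \<le> \<phi> y + m * (s - y)"
        proof (cases "x0 = y")
          case False
          have "(y - x0) * \<phi> s \<le> (y - s) * \<phi> x0 + (s - x0) * \<phi> y" using chord that by blast
          also have "\<dots> \<le> (y - s) * (\<phi> y - m * (y - x0)) + (s - x0) * \<phi> y"
            using m[of y] that by (intro add_right_mono mult_left_mono) auto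
          also have "\<dots> = (y - x0) * (\<phi> y + m * (s - y))" by (simp add: algebra_simps)
          finally show ?thesis using False True by simp
        qed (use that in simp)
        then show ?thesis by (simp add: f_exp exp_add[symmetric])
      qed
      have "f y * exp (m * (x0 - y)) / m - F x0 \<le> f y * exp (m * (y - y)) / m - F y"
      proof (rule DERIV_nonneg_imp_nondecreasing[OF True])
        fix s assume "x0 \<le> s" "s \<le> y"
        then show "\<exists>z. ((\<lambda>s. f y * exp (m * (s - y)) / m - F s) has_real_derivative z) (at s) \<and> 0 \<le> z"
          using m_pos upper[of s]
          by (intro exI[of _ "f y * exp (m * (s - y)) - f s"] conjI)
            (auto intro!: derivative_eq_intros F_deriv)
      qed
      from mult_left_mono[OF this, of m] m_pos
      have "m * (F y - F x0) \<le> f y - f y * exp (m * (x0 - y))"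
        by (simp add: right_diff_distrib)
      moreover have "f x0 \<le> f y * exp (m * (x0 - y))" using upper[of x0] True by simp
      ultimately show ?thesis by simp
    next
      case False
      then have "y \<le> x0" by simp
      \<comment> \<open>To the left of \<open>x0\<close> the exponential through \<open>f x0\<close>
        lies below the density; integrating it bounds \<open>F x0 - F y\<close> from below.\<close>
      have "F y - f x0 * exp (m * (y - x0)) / m \<le> F x0 - f x0 * exp (m * (x0 - x0)) / m"
      proof (rule DERIV_nonneg_imp_nondecreasing[OF \<open>y \<le> x0\<close>])
        fix s
        show "\<exists>z. ((\<lambda>s. F s - f x0 * exp (m * (s - x0)) / m) has_real_derivative z) (at s) \<and> 0 \<le> z"
          using m_pos lower[of s]
          by (intro exI[of _ "f s - f x0 * exp (m * (s - x0))"] conjI)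
            (auto intro!: derivative_eq_intros F_deriv)
      qed
      from mult_left_mono[OF this, of m] m_pos
      have "f x0 - f x0 * exp (m * (y - x0)) \<le> m * (F x0 - F y)"
        by (simp add: right_diff_distrib)
      then show ?thesis using lower[of y] by (simp add: algebra_simps)
    qed
    from this[of "inv F _"] show ?thesis by auto
  qed
  have g_chord: "(r - l) * f (inv F t) \<le> (r - t) * f (inv F l) + (t - l) * f (inv F r)"
    if "0 \<le> l" "l \<le> t" "t \<le> r" for l t r
  \<comment> \<open>Supporting lines are available for positive \<open>t\<close>. At
    \<open>t = 0\<close> also \<open>l = 0\<close>, and the two sides are equal.\<close>
  proof (cases "t = 0")
    case False
    then have "0 < inv F t" using inv_less[of 0 t] inv0 that by simp
    from support[OF this] obtain m where m: "\<And>s. f (inv F t) + m * (s - t) \<le> f (inv F s)" by auto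
    have "(r - t) * (f (inv F t) + m * (l - t)) + (t - l) * (f (inv F t) + m * (r - t))
        \<le> (r - t) * f (inv F l) + (t - l) * f (inv F r)"
      using m that by (intro add_mono mult_left_mono) auto
    then show ?thesis by (simp add: algebra_simps)
  qed (use that in simp)
  have "convex_line_density f F"
  proof
    show "0 < f (inv F 0)" by (rule fpos)
    show "f (inv F (- t)) = f (inv F t)" for t by (simp add: inv_odd fsym)
    show "f (inv F s) < f (inv F t)" if "0 \<le> s" "s < t" for s t
    proof (rule f_strict)
      show "0 \<le> inv F s" using inv_less[of s 0] inv0 that by simp
    qed (use that inv_less in blast)
    show "f (inv F (l + d)) + f (inv F (r - d)) \<le> f (inv F l) + f (inv F r)"
      if "0 \<le> l" "0 \<le> d" "l + d \<le> r" for l d r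
    proof (cases "l = r")
      case False
      have "(r - l) * f (inv F (l + d)) \<le> (r - (l + d)) * f (inv F l) + (l + d - l) * f (inv F r)"
        "(r - l) * f (inv F (r - d)) \<le> (r - (r - d)) * f (inv F l) + (r - d - l) * f (inv F r)"
        by (rule g_chord; use that in simp)+
      then have "(r - l) * (f (inv F (l + d)) + f (inv F (r - d)))
          \<le> (r - l) * (f (inv F l) + f (inv F r))"
        by (simp add: algebra_simps)
      then show ?thesis using False that by simp
    qed (use that in simp)
  qed
  with F0 show ?thesis using that by blast
qed

section \<open>Existence of minimizers\<close>

text \<open>Tychonoff's theorem; infinite sequences give one ambient space for words of every
  length.\<close>

lemma compact_box:
  "compact {q :: nat \<Rightarrow> real. \<forall>i. q i \<in> {A..B}}"
proof -
  have "compactin (product_topology (\<lambda>_::nat. euclidean :: real topology) UNIV) (PiE UNIV (\<lambda>_. {A..B}))"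
    by (simp add: compactin_PiE)
  then have "compact (PiE UNIV (\<lambda>_::nat. {A..B}))" by (simp add: euclidean_product_topology)
  moreover have "PiE UNIV (\<lambda>_::nat. {A..B}) = {q. \<forall>i. q i \<in> {A..B}}" by auto
  ultimately show ?thesis by simp
qed

lemma closed_nondecreasing: "closed {q :: nat \<Rightarrow> real. \<forall>j<n. q j \<le> q (Suc j)}"
  unfolding Collect_all_eq Collect_imp_eq
  by (intro closed_INT ballI closed_Un closed_Collect_le continuous_on_product_coordinates)
    (auto intro: continuous_on_product_coordinates)

context convex_line_density
begin

text \<open>By convexity every unit step raises the profile by at least as much as the step from 0
  to 1, so it grows at least linearly.\<close>

lemma profile_unbounded: "\<exists>R. \<forall>t. f (inv F t) \<le> C \<longrightarrow> \<bar>t\<bar> \<le> R"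
proof -
  define c where "c = f (inv F 1) - f (inv F 0)"
  have "0 < c" using g_strict[of 0 1] by (simp add: c_def)
  have lin: "f (inv F 0) + real n * c \<le> f (inv F (real n))" for n
  proof (induction n)
    case (Suc n)
    have "f (inv F (0 + 1)) + f (inv F (real (Suc n) - 1)) \<le> f (inv F 0) + f (inv F (real (Suc n)))"
      by (rule g_spread) auto
    then show ?case using Suc by (simp add: c_def algebra_simps)
  qed simp
  obtain n :: nat where n: "C < real n * c" using reals_Archimedean3[OF \<open>0 < c\<close>] by blast
  have "\<bar>t\<bar> \<le> real n" if "f (inv F t) \<le> C" for t
  proof (rule ccontr)
    assume "\<not> \<bar>t\<bar> \<le> real n"
    then have "f (inv F (real n)) < f (inv F \<bar>t\<bar>)" by (intro g_strict) auto
    moreover have "f (inv F \<bar>t\<bar>) = f (inv F t)" using g_even[of t] by (simp add: abs_if)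
    ultimately show False using that n lin[of n] g_zero_pos by simp
  qed
  then show ?thesis by blast
qed

text \<open>Perimeter at most \<open>C\<close> bounds the positions of the boundary points, since
  the profile is unbounded, and their number, since each costs at least the value at 0. This leaves
  finitely many words, each with a compact set of weakly increasing sequences. A degenerate optimum
  still yields a bubble of no larger perimeter by \<open>triple_bubble_exists\<close>.\<close>

lemma minimizer_exists:
  assumes cont: "continuous_on UNIV f" and E0: "triple_bubble f V E0"
    and pos: "\<forall>k\<in>labels. 0 < V k"
  shows "\<exists>E. perimeter_minimizing f V E"
proof -
  define C where "C = perimeter f E0"
  obtain R where R: "\<And>t. f (inv F t) \<le> C \<Longrightarrow> \<bar>t\<bar> \<le> R" using profile_unbounded by blast
  obtain N :: nat where N: "C < real N * f (inv F 0)"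
    using reals_Archimedean3[OF g_zero_pos] by blast
  define K where "K w = {q. (\<forall>i. q i \<in> {inv F (- R) .. inv F R}) \<and> (\<forall>j<length w. q j \<le> q (Suc j)) \<and>
      (\<forall>k\<in>labels. region_volume (F \<circ> q) w k = V k)}" for w
  define cost where "cost w q = (\<Sum>j\<le>length w. f (q j))" for w :: "nat list" and q :: "nat \<Rightarrow> real"
  have F_cont: "continuous_on UNIV F"
    using F_deriv by (meson DERIV_isCont continuous_at_imp_continuous_on)
  have coord: "continuous_on S (\<lambda>q::nat \<Rightarrow> real. q j)" for S j
    by (rule continuous_on_subset[OF continuous_on_product_coordinates]) simp
  have f_coord: "continuous_on S (\<lambda>q. f (q j))" and F_coord: "continuous_on S (\<lambda>q. F (q j))"
    for S and j :: nat
    by (rule continuous_on_compose2[OF cont coord] continuous_on_compose2[OF F_cont coord]; simp)+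
  have K: "compact (K w)" for w
  proof -
    have "closed {q. region_volume (F \<circ> q) w k = V k}" for k
      unfolding region_volume_def comp_def
      by (intro closed_Collect_eq continuous_intros F_coord)
    then have "closed ({q. \<forall>j<length w. q j \<le> q (Suc j)} \<inter> (\<Inter>k\<in>labels. {q. region_volume (F \<circ> q) w k = V k}))"
      by (intro closed_Int closed_nondecreasing closed_INT ballI)
    then have "compact ({q. \<forall>i. q i \<in> {inv F (- R) .. inv F R}} \<inter>
      ({q. \<forall>j<length w. q j \<le> q (Suc j)} \<inter> (\<Inter>k\<in>labels. {q. region_volume (F \<circ> q) w k = V k})))"
      by (intro compact_Int_closed compact_box)
    moreover have "\<dots> = K w" unfolding K_def by blast
    ultimately show ?thesis by (simp only:)
  qed
  define W where "W = {w. set w \<subseteq> {0, 1, 2, 3} \<and> length w \<le> N \<and> K w \<noteq> {}}"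
  have finW: "finite W"
    by (rule finite_subset[OF _ finite_lists_length_le[of "{0, 1, 2, 3}" N]]) (auto simp: W_def)
  have "\<exists>q\<in>K w. \<forall>q'\<in>K w. cost w q \<le> cost w q'" if "w \<in> W" for w
    by (rule continuous_attains_inf[OF K])
      (use that in \<open>auto simp: W_def cost_def intro!: continuous_on_sum f_coord\<close>)
  then obtain Q where Q: "\<And>w. w \<in> W \<Longrightarrow> Q w \<in> K w"
    and Qmin: "\<And>w q. w \<in> W \<Longrightarrow> q \<in> K w \<Longrightarrow> cost w (Q w) \<le> cost w q" by metis
  have small: "\<exists>w\<in>W. \<exists>q\<in>K w. cost w q = perimeter f G"
    if G: "triple_bubble f V G" and le: "perimeter f G \<le> C" for G
  proof -
    have "integral (G 1) f = V 1" using G by (simp add: triple_bubble_def)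
    then have "G 1 \<noteq> {}" using pos by auto
    then have "\<exists>q w. tiling G q w" by (intro tiling_exists[OF G] bexI[of _ 1]) simp_all
    then obtain q w where t: "tiling G q w" by blast
    define n where "n = length w"
    \<comment> \<open>The coordinates beyond \<open>n\<close> repeat the last boundary point, which
      keeps the whole sequence in the box.\<close>
    define q' where "q' j = q (min j n)" for j
    have perim: "perimeter f G = (\<Sum>j\<le>n. f (q j))" using tiling_perimeter[OF t] by (simp add: n_def)
    have box: "q j \<in> {inv F (- R) .. inv F R}" if "j \<le> n" for j
    proof -
      have "f (q j) \<le> (\<Sum>j\<le>n. f (q j))"
        by (rule member_le_sum) (use that f_pos in \<open>auto simp: less_imp_le\<close>)
      then have "f (inv F (F (q j))) \<le> C" using perim le by simp
      from R[OF this] have "F (inv F (- R)) \<le> F (q j)" "F (q j) \<le> F (inv F R)" by auto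
      then show ?thesis by (simp only: F_le_iff atLeastAtMost_iff)
    qed
    have "(\<Sum>j\<le>n. f (inv F 0)) \<le> (\<Sum>j\<le>n. f (q j))"
      using g_ge[of "F (q _)"] by (intro sum_mono) simp
    then have "real (Suc n) * f (inv F 0) < real N * f (inv F 0)" using perim le N by simp
    then have "n \<le> N" using g_zero_pos by simp
    have vol: "region_volume (F \<circ> q') w k = region_volume (F \<circ> q) w k" for k
      unfolding region_volume_def by (intro sum.cong) (auto simp: q'_def n_def)
    have "q' \<in> K w"
      unfolding K_def
    proof (intro CollectI conjI allI impI ballI)
      show "q' i \<in> {inv F (- R) .. inv F R}" for i unfolding q'_def by (rule box) simp
      show "q' j \<le> q' (Suc j)" if "j < length w" for j
        using tilingD(3)[OF t, of j] that by (simp add: q'_def n_def)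
      show "region_volume (F \<circ> q') w k = V k" if "k \<in> labels" for k
        unfolding vol by (rule tiling_volume[OF t G that])
    qed
    moreover have "w \<in> W"
      unfolding W_def using \<open>q' \<in> K w\<close> tilingD(1)[OF t] \<open>n \<le> N\<close> by (auto simp: n_def)
    moreover have "cost w q' = perimeter f G"
      unfolding cost_def perim n_def[symmetric] by (rule sum.cong) (auto simp: q'_def)
    ultimately show ?thesis by blast
  qed
  have "W \<noteq> {}" using small[OF E0] by (auto simp: C_def)
  obtain w where w: "w \<in> W" and wmin: "\<And>w'. w' \<in> W \<Longrightarrow> cost w (Q w) \<le> cost w' (Q w')"
    using ex_is_arg_min_if_finite[OF finW \<open>W \<noteq> {}\<close>, of "\<lambda>w. cost w (Q w)"]
    by (auto simp: is_arg_min_linorder)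
  have Qw: "\<forall>j<length w. Q w j \<le> Q w (Suc j)" "\<forall>k\<in>labels. region_volume (F \<circ> Q w) w k = V k"
    using Q[OF w] unfolding K_def by blast+
  have "\<forall>j<length w. (F \<circ> Q w) j \<le> (F \<circ> Q w) (Suc j)" using Qw(1) by (simp add: F_le_iff)
  from triple_bubble_exists[OF this Qw(2)] obtain E where E: "triple_bubble f V E"
    and perE: "perimeter f E \<le> cost w (Q w)"
    by (auto simp: cost_def)
  have best: "perimeter f E \<le> perimeter f G" if "triple_bubble f V G" "perimeter f G \<le> C" for G
  proof -
    obtain w' q where "w' \<in> W" "q \<in> K w'" "cost w' q = perimeter f G"
      using small[OF \<open>triple_bubble f V G\<close> \<open>perimeter f G \<le> C\<close>] by blast
    then show ?thesis using perE wmin[of w'] Qmin[of w' q] by simp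
  qed
  have "perimeter f E \<le> C" using best[OF E0] by (simp add: C_def)
  then have "perimeter f E \<le> perimeter f G" if "triple_bubble f V G" for G
    using best[OF that] by (cases "perimeter f G \<le> C") auto
  then show ?thesis using E by (auto simp: perimeter_minimizing_def)
qed

end

section \<open>A density with quadratic profile\<close>

lemma strictly_convex_deriv:
  fixes \<phi> D :: "real \<Rightarrow> real"
  assumes \<phi>: "\<And>x. (\<phi> has_real_derivative D x) (at x)" and D: "strict_mono D"
    and "x < y" "0 < t" "t < 1"
  shows "\<phi> ((1 - t) * x + t * y) < (1 - t) * \<phi> x + t * \<phi> y"
proof -
  define z where "z = (1 - t) * x + t * y"
  have zx: "z - x = t * (y - x)" and yz: "y - z = (1 - t) * (y - x)"
    by (simp_all add: z_def algebra_simps)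
  then have "0 < z - x" "0 < y - z" using assms by simp_all
  then have "x < z" "z < y" by simp_all
  obtain \<xi> where \<xi>: "\<xi> < z" "\<phi> z - \<phi> x = (z - x) * D \<xi>" using MVT2[OF \<open>x < z\<close> \<phi>] by blast
  obtain \<eta> where \<eta>: "z < \<eta>" "\<phi> y - \<phi> z = (y - z) * D \<eta>" using MVT2[OF \<open>z < y\<close> \<phi>] by blast
  have "(1 - t) * (t * (y - x)) * D \<xi> < (1 - t) * (t * (y - x)) * D \<eta>"
    using strict_monoD[OF D, of \<xi> \<eta>] \<xi> \<eta> assms by (intro mult_strict_left_mono) auto
  then have "(1 - t) * (\<phi> z - \<phi> x) < t * (\<phi> y - \<phi> z)"
    unfolding \<xi>(2) \<eta>(2) zx yz by (simp add: algebra_simps)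
  then show ?thesis unfolding z_def[symmetric] by (simp add: algebra_simps)
qed

text \<open>The density is sec x ^ 2, for which the density as a function of the volume is 1 + t ^ 2, up to
  volume 100; it has to be continued differently before x reaches pi / 2.\<close>

lemma quadratic_profile_density:
  obtains f where "positive_density f" "symmetric_density f" "strictly_log_convex f"
    "f C1_differentiable_on UNIV" "log_convex f" "\<And>x. x \<noteq> 0 \<Longrightarrow> f 0 < f x"
    "\<And>x. \<bar>x\<bar> \<le> arctan 100 \<Longrightarrow> f x = 1 / (cos x)\<^sup>2"
proof -
  define c where "c = arctan 100"
  have c: "0 < c" "c < pi / 2" using arctan_ubound by (auto simp: c_def)
  define h where "h x = max (- c) (min c x)" for x
  define D where "D x = 2 * tan (h x) + (x - h x)" for x
  have h: "- (pi / 2) < h x" "h x < pi / 2" for x using c by (auto simp: h_def)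
  then have "cos (h x) \<noteq> 0" for x using cos_gt_zero_pi[of "h x"] by auto
  then have D_cont: "continuous_on UNIV D"
    unfolding D_def h_def by (intro continuous_intros) auto
  obtain \<phi> where \<phi>: "\<And>x. (\<phi> has_real_derivative D x) (at x)" and \<phi>0: "\<phi> 0 = 0"
    using primitive_exists[OF D_cont] by metis
  have D_mono: "strict_mono D"
  proof (rule strict_monoI)
    fix x y :: real assume "x < y"
    then have "h x \<le> h y" "x - h x \<le> y - h y"
      using c unfolding h_def by linarith+
    then consider "h x < h y" "x - h x \<le> y - h y" | "h x = h y" "x - h x < y - h y"
      using \<open>x < y\<close> by linarith
    then show "D x < D y"
    proof cases
      case 1
      then have "tan (h x) < tan (h y)" using h by (intro tan_monotone) auto
      then show ?thesis using 1 by (simp add: D_def)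
    qed (simp add: D_def)
  qed
  have D_odd: "D (- x) = - D x" for x
  proof -
    have "h (- x) = - h x" using c by (auto simp: h_def min_def max_def)
    then show ?thesis by (simp add: D_def)
  qed
  have \<phi>_even: "\<phi> (- x) = \<phi> x" for x
  proof -
    have "((\<lambda>x. \<phi> x - \<phi> (- x)) has_real_derivative 0) (at x)" for x
      using DERIV_diff[OF \<phi>[of x] DERIV_chain2[OF \<phi>[of "- x"] DERIV_minus[OF DERIV_ident]]]
      by (simp add: D_odd)
    then have "\<phi> x - \<phi> (- x) = \<phi> 0 - \<phi> (- 0)" by (intro DERIV_isconst_all) blast
    then show ?thesis by simp
  qed
  have strict: "\<phi> ((1 - t) * x + t * y) < (1 - t) * \<phi> x + t * \<phi> y"
    if "x \<noteq> y" "0 < t" "t < 1" for x y t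
  proof (cases "x < y")
    case True
    then show ?thesis using strictly_convex_deriv[OF \<phi> D_mono] that by blast
  next
    case False
    then show ?thesis using strictly_convex_deriv[OF \<phi> D_mono, of y x "1 - t"] that
      by (simp add: algebra_simps)
  qed
  define f where "f x = exp (\<phi> x)" for x
  have f_deriv: "(f has_real_derivative f x * D x) (at x)" for x
    unfolding f_def by (rule DERIV_fun_exp[OF \<phi>])
  have f_cont: "continuous_on UNIV f"
    using f_deriv by (meson DERIV_isCont continuous_at_imp_continuous_on)
  have C1: "f C1_differentiable_on UNIV"
    unfolding C1_differentiable_on_def
    using f_deriv continuous_on_mult[OF f_cont D_cont]
    by (intro exI[of _ "\<lambda>x. f x * D x"]) (auto simp: has_real_derivative_iff_has_vector_derivative)
  have lc: "log_convex f"
    unfolding log_convex_def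
  proof (rule convex_onI)
    fix t x y :: real assume "0 < t" "t < 1"
    then show "ln (f ((1 - t) *\<^sub>R x + t *\<^sub>R y)) \<le> (1 - t) * ln (f x) + t * ln (f y)"
      using strict[of x y t] by (cases "x = y") (auto simp: f_def algebra_simps)
  qed simp
  have min0: "f 0 < f x" if "x \<noteq> 0" for x
    using strict[of x "- x" "1 / 2"] that by (simp add: f_def \<phi>_even)
  have sec: "f x = 1 / (cos x)\<^sup>2" if "\<bar>x\<bar> \<le> arctan 100" for x
  proof -
    have "\<exists>K. \<forall>x\<in>{- c .. c}. f x * (cos x)\<^sup>2 = K"
    proof (rule has_field_derivative_zero_constant)
      fix x assume x: "x \<in> {- c .. c}"
      then have "h x = x" by (auto simp: h_def)
      moreover have "cos x \<noteq> 0" using cos_gt_zero_pi[of x] x c by auto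
      ultimately have "D x * (cos x)\<^sup>2 = 2 * sin x * cos x"
        by (simp add: D_def tan_def power2_eq_square)
      then have "f x * D x * (cos x)\<^sup>2 + f x * (2 * cos x * - sin x) = 0"
        by (simp add: algebra_simps)
      moreover have "((\<lambda>x. f x * (cos x)\<^sup>2) has_real_derivative
          f x * D x * (cos x)\<^sup>2 + f x * (2 * cos x * - sin x)) (at x)"
        by (auto intro!: derivative_eq_intros f_deriv)
      ultimately show "((\<lambda>x. f x * (cos x)\<^sup>2) has_real_derivative 0) (at x within {- c .. c})"
        by (metis DERIV_subset subset_UNIV)
    qed simp
    then obtain K where K: "\<And>x. x \<in> {- c .. c} \<Longrightarrow> f x * (cos x)\<^sup>2 = K" by blast
    have "f x * (cos x)\<^sup>2 = f 0 * (cos 0)\<^sup>2"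
      using K[of x] K[of 0] that c by (simp add: c_def abs_le_iff)
    moreover have "cos x \<noteq> 0" using cos_gt_zero_pi[of x] that c by (auto simp: c_def abs_le_iff)
    ultimately show ?thesis by (simp add: f_def \<phi>0 field_simps)
  qed
  have "positive_density f" "symmetric_density f" "strictly_log_convex f"
    using strict
    by (auto simp: positive_density_def symmetric_density_def strictly_log_convex_def f_def \<phi>_even)
  then show ?thesis using C1 lc min0 sec by (rule that)
qed

locale quadratic_profile = convex_line_density +
  assumes f_sym: "symmetric_density f" and f_cont: "continuous_on UNIV f"
    and profile: "\<bar>t\<bar> \<le> 100 \<Longrightarrow> f (inv F t) = 1 + t\<^sup>2"
begin

lemma minimizing_type:
  assumes V: "0 < V 1" "V 1 \<le> V 2" "V 2 \<le> V 3"
    and w0: "set w0 \<subseteq> labels"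
    and p0: "\<forall>j<length w0. p0 j \<le> p0 (Suc j)" "\<forall>k\<in>labels. region_volume p0 w0 k = V k"
      "\<forall>j\<le>length w0. \<bar>p0 j\<bar> \<le> 100" "(\<Sum>j\<le>length w0. 1 + (p0 j)\<^sup>2) \<le> C" "C \<le> 10000"
    and other: "\<And>w p. \<lbrakk>w \<in> four_types; w \<noteq> w0; \<forall>k\<in>labels. region_volume p w k = V k\<rbrakk>
      \<Longrightarrow> C < (\<Sum>j\<le>length w. 1 + (p j)\<^sup>2)"
  shows "\<exists>E. perimeter_minimizing f V E \<and> has_type E w0"
proof -
  obtain E0 where E0: "triple_bubble f V E0"
    and E0': "perimeter f E0 \<le> (\<Sum>j\<le>length w0. f (inv F (p0 j)))"
    using triple_bubble_exists[OF p0(1,2)] by blast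
  note E0'
  also have "\<dots> = (\<Sum>j\<le>length w0. 1 + (p0 j)\<^sup>2)"
    using p0(3) by (intro sum.cong) (auto simp: profile)
  finally have E0C: "perimeter f E0 \<le> C" using p0(4) by simp
  obtain E where E: "perimeter_minimizing f V E"
    using minimizer_exists[OF f_cont E0] V by auto
  obtain \<sigma> w q where \<sigma>: "\<sigma> permutes labels" "\<forall>k\<in>labels. V (\<sigma> k) = V k" and w: "w \<in> four_types"
    and t: "tiling (E \<circ> \<sigma>) q w \<or> tiling (reflect (E \<circ> \<sigma>)) q w"
    by (rule minimizing_tiling[OF E V]) (rule that)
  have E\<sigma>: "perimeter_minimizing f V (E \<circ> \<sigma>)" by (rule permute_minimizing[OF E \<sigma>])
  have "\<exists>E'. perimeter_minimizing f V E' \<and> tiling E' q w"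
  proof (cases "tiling (E \<circ> \<sigma>) q w")
    case False
    then have t': "tiling (reflect (E \<circ> \<sigma>)) q w" using t by blast
    have "triple_bubble f V (E \<circ> \<sigma>)" using E\<sigma> by (simp add: perimeter_minimizing_def)
    moreover have "reflect (reflect (E \<circ> \<sigma>)) = E \<circ> \<sigma>" by (simp add: reflect_def fun_eq_iff image_image)
    ultimately have "perimeter_minimizing f V (reflect (E \<circ> \<sigma>))"
      using reflect_minimizing[OF f_sym E\<sigma>] tiling_reflect[OF t'] by metis
    then show ?thesis using t' by blast
  qed (use E\<sigma> in blast)
  then obtain E' where E': "perimeter_minimizing f V E'" and t': "tiling E' q w" by blast
  have bub: "triple_bubble f V E'" using E' by (simp add: perimeter_minimizing_def)
  have le: "perimeter f E' \<le> C" using E' E0 E0C unfolding perimeter_minimizing_def by fastforce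
  have perim: "perimeter f E' = (\<Sum>j\<le>length w. f (inv F (F (q j))))"
    using tiling_perimeter[OF t'] by simp
  have small: "\<bar>F (q j)\<bar> \<le> 100" if "j \<le> length w" for j
  proof (rule ccontr)
    assume "\<not> \<bar>F (q j)\<bar> \<le> 100"
    then have "f (inv F 100) < f (inv F \<bar>F (q j)\<bar>)" by (intro g_strict) auto
    also have "f (inv F \<bar>F (q j)\<bar>) = f (inv F (F (q j)))"
      using g_even[of "F (q j)"] by (simp add: abs_if)
    also have "\<dots> \<le> (\<Sum>j\<le>length w. f (inv F (F (q j))))"
      by (rule member_le_sum) (use that f_pos in \<open>auto simp: less_imp_le\<close>)
    also have "\<dots> \<le> 10000" using perim le p0(5) by simp
    finally show False using profile[of 100] by simp
  qed
  have "perimeter f E' = (\<Sum>j\<le>length w. 1 + ((F \<circ> q) j)\<^sup>2)"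
    unfolding perim using profile[OF small] by (intro sum.cong) simp_all
  then have "w = w0"
    using other[OF w _ ballI[OF tiling_volume[OF t' bub]]] le by force
  then show ?thesis using E' tiling_has_type[OF t'] w0 by blast
qed

end

section \<open>The four types\<close>

lemma region_volume_four_types:
  "region_volume p [2, 1, 3] k =
    (if k = 2 then p 1 - p 0 else 0) + (if k = 1 then p 2 - p 1 else 0)
    + (if k = 3 then p 3 - p 2 else 0)"
  "region_volume p [3, 1, 2, 3] k =
    (if k = 3 then p 1 - p 0 + p 4 - p 3 else 0) + (if k = 1 then p 2 - p 1 else 0)
    + (if k = 2 then p 3 - p 2 else 0)"
  "region_volume p [2, 3, 1, 3] k =
    (if k = 2 then p 1 - p 0 else 0) + (if k = 3 then p 2 - p 1 + p 4 - p 3 else 0)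
    + (if k = 1 then p 3 - p 2 else 0)"
  "region_volume p [3, 2, 1, 2, 3] k =
    (if k = 3 then p 1 - p 0 + p 5 - p 4 else 0) + (if k = 2 then p 2 - p 1 + p 4 - p 3 else 0)
    + (if k = 1 then p 3 - p 2 else 0)"
  by (simp_all add: region_volume_pieces upt_rec eval_nat_numeral)

lemma sum_four_types:
  fixes h :: "nat \<Rightarrow> real"
  shows "(\<Sum>j\<le>length [2, 1, 3::nat]. h j) = h 0 + h 1 + h 2 + h 3"
    "(\<Sum>j\<le>length [3, 1, 2, 3::nat]. h j) = h 0 + h 1 + h 2 + h 3 + h 4"
    "(\<Sum>j\<le>length [2, 3, 1, 3::nat]. h j) = h 0 + h 1 + h 2 + h 3 + h 4"
    "(\<Sum>j\<le>length [3, 2, 1, 2, 3::nat]. h j) = h 0 + h 1 + h 2 + h 3 + h 4 + h 5"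
  by (simp_all add: eval_nat_numeral)

lemma square_sums:
  fixes a b c d :: real
  shows "(b - a)\<^sup>2 \<le> 2 * (a\<^sup>2 + b\<^sup>2)"
    "(b - a)\<^sup>2 + (c - a)\<^sup>2 + (c - b)\<^sup>2 \<le> 3 * (a\<^sup>2 + b\<^sup>2 + c\<^sup>2)"
    "(b - a)\<^sup>2 + (c - a)\<^sup>2 + (d - a)\<^sup>2 + (c - b)\<^sup>2 + (d - b)\<^sup>2 + (d - c)\<^sup>2
      \<le> 4 * (a\<^sup>2 + b\<^sup>2 + c\<^sup>2 + d\<^sup>2)"
proof -
  have "0 \<le> (a + b)\<^sup>2" "0 \<le> (a + b + c)\<^sup>2" "0 \<le> (a + b + c + d)\<^sup>2" by simp_all
  then show "(b - a)\<^sup>2 \<le> 2 * (a\<^sup>2 + b\<^sup>2)"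
    "(b - a)\<^sup>2 + (c - a)\<^sup>2 + (c - b)\<^sup>2 \<le> 3 * (a\<^sup>2 + b\<^sup>2 + c\<^sup>2)"
    "(b - a)\<^sup>2 + (c - a)\<^sup>2 + (d - a)\<^sup>2 + (c - b)\<^sup>2 + (d - b)\<^sup>2 + (d - c)\<^sup>2
      \<le> 4 * (a\<^sup>2 + b\<^sup>2 + c\<^sup>2 + d\<^sup>2)"
    by (simp_all add: power2_eq_square algebra_simps)
qed

definition quadratic_bound :: "(nat \<Rightarrow> real) \<Rightarrow> nat list \<Rightarrow> real" where
  "quadratic_bound V w =
    (if w = [2, 1, 3] then 4 + ((V 2)\<^sup>2 + (V 2 + V 1)\<^sup>2 + (V 2 + V 1 + V 3)\<^sup>2 + (V 1)\<^sup>2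
       + (V 1 + V 3)\<^sup>2 + (V 3)\<^sup>2) / 4
     else if w = [3, 1, 2, 3] then 5 + (V 1 + V 2 + V 3)\<^sup>2 / 2 + ((V 1)\<^sup>2 + (V 1 + V 2)\<^sup>2 + (V 2)\<^sup>2) / 3
     else if w = [2, 3, 1, 3] then 5 + ((V 2)\<^sup>2 + (V 1 + V 2 + V 3)\<^sup>2 + (V 1 + V 3)\<^sup>2) / 3
     else 6 + (V 1 + V 2 + V 3)\<^sup>2 / 2 + (V 1 + V 2)\<^sup>2 / 2)"

lemma quadratic_bound_le:
  assumes w: "w \<in> four_types" and V: "\<forall>k\<in>labels. region_volume p w k = V k"
  shows "quadratic_bound V w \<le> (\<Sum>j\<le>length w. 1 + (p j)\<^sup>2)"
proof -
  note V' = V[THEN bspec, of 1] V[THEN bspec, of 2] V[THEN bspec, of 3]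
  from w consider "w = [2, 1, 3]" | "w = [3, 1, 2, 3]" | "w = [2, 3, 1, 3]" | "w = [3, 2, 1, 2, 3]"
    by (auto simp: four_types_def)
  then show ?thesis
  proof cases
    case 1
    have d: "p 1 - p 0 = V 2" "p 2 - p 0 = V 2 + V 1" "p 3 - p 0 = V 2 + V 1 + V 3"
      "p 2 - p 1 = V 1" "p 3 - p 1 = V 1 + V 3" "p 3 - p 2 = V 3"
      using V' unfolding 1 region_volume_four_types by simp_all
    define D where "D = (V 2)\<^sup>2 + (V 2 + V 1)\<^sup>2 + (V 2 + V 1 + V 3)\<^sup>2 + (V 1)\<^sup>2 + (V 1 + V 3)\<^sup>2 + (V 3)\<^sup>2"
    have "D \<le> 4 * ((p 0)\<^sup>2 + (p 1)\<^sup>2 + (p 2)\<^sup>2 + (p 3)\<^sup>2)"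
      using square_sums(3)[of "p 1" "p 0" "p 2" "p 3"] unfolding d D_def .
    moreover have "quadratic_bound V [2, 1, 3] = 4 + D / 4" by (simp add: quadratic_bound_def D_def)
    ultimately show ?thesis unfolding 1 sum_four_types by argo
  next
    case 2
    have d: "p 4 - p 0 = V 1 + V 2 + V 3" "p 2 - p 1 = V 1" "p 3 - p 1 = V 1 + V 2" "p 3 - p 2 = V 2"
      using V' unfolding 2 region_volume_four_types by simp_all
    define A B where "A = (V 1 + V 2 + V 3)\<^sup>2" and "B = (V 1)\<^sup>2 + (V 1 + V 2)\<^sup>2 + (V 2)\<^sup>2"
    have "A \<le> 2 * ((p 0)\<^sup>2 + (p 4)\<^sup>2)" "B \<le> 3 * ((p 1)\<^sup>2 + (p 2)\<^sup>2 + (p 3)\<^sup>2)"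
      using square_sums(1)[of "p 4" "p 0"] square_sums(2)[of "p 2" "p 1" "p 3"]
      unfolding d A_def B_def .
    moreover have "quadratic_bound V [3, 1, 2, 3] = 5 + A / 2 + B / 3"
      by (simp add: quadratic_bound_def A_def B_def)
    ultimately show ?thesis unfolding 2 sum_four_types by argo
  next
    case 3
    have d: "p 1 - p 0 = V 2" "p 4 - p 0 = V 1 + V 2 + V 3" "p 4 - p 1 = V 1 + V 3"
      using V' unfolding 3 region_volume_four_types by simp_all
    define B where "B = (V 2)\<^sup>2 + (V 1 + V 2 + V 3)\<^sup>2 + (V 1 + V 3)\<^sup>2"
    have "B \<le> 3 * ((p 0)\<^sup>2 + (p 1)\<^sup>2 + (p 4)\<^sup>2)"
      using square_sums(2)[of "p 1" "p 0" "p 4"] unfolding d B_def .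
    moreover have "0 \<le> (p 2)\<^sup>2" "0 \<le> (p 3)\<^sup>2" by simp_all
    moreover have "quadratic_bound V [2, 3, 1, 3] = 5 + B / 3"
      by (simp add: quadratic_bound_def B_def)
    ultimately show ?thesis unfolding 3 sum_four_types by argo
  next
    case 4
    have d: "p 5 - p 0 = V 1 + V 2 + V 3" "p 4 - p 1 = V 1 + V 2"
      using V' unfolding 4 region_volume_four_types by simp_all
    define A B where "A = (V 1 + V 2 + V 3)\<^sup>2" and "B = (V 1 + V 2)\<^sup>2"
    have "A \<le> 2 * ((p 0)\<^sup>2 + (p 5)\<^sup>2)" "B \<le> 2 * ((p 1)\<^sup>2 + (p 4)\<^sup>2)"
      using square_sums(1)[of "p 5" "p 0"] square_sums(1)[of "p 4" "p 1"]
      unfolding d A_def B_def .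
    moreover have "0 \<le> (p 2)\<^sup>2" "0 \<le> (p 3)\<^sup>2" by simp_all
    moreover have "quadratic_bound V [3, 2, 1, 2, 3] = 6 + A / 2 + B / 2"
      by (simp add: quadratic_bound_def A_def B_def)
    ultimately show ?thesis unfolding 4 sum_four_types by argo
  qed
qed

lemma (in quadratic_profile) all_types_occur:
  assumes "w0 \<in> four_types"
  shows "\<exists>V E. 0 < V 1 \<and> V 1 \<le> V 2 \<and> V 2 \<le> V 3 \<and> perimeter_minimizing f V E \<and> has_type E w0"
proof -
  have by_bounds: "\<exists>V E. 0 < V 1 \<and> V 1 \<le> V 2 \<and> V 2 \<le> V 3 \<and> perimeter_minimizing f V E \<and> has_type E w"
    if V: "0 < V 1" "V 1 \<le> V 2" "V 2 \<le> V 3" and w: "w \<in> four_types"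
      and p: "\<forall>j<length w. p j \<le> p (Suc j)" "\<forall>k\<in>labels. region_volume p w k = V k"
        "\<forall>j\<le>length w. \<bar>p j\<bar> \<le> 100" "(\<Sum>j\<le>length w. 1 + (p j)\<^sup>2) \<le> C" "C \<le> 10000"
      and C: "\<forall>w'\<in>four_types - {w}. C < quadratic_bound V w'" for V w p C
  proof -
    have "\<exists>E. perimeter_minimizing f V E \<and> has_type E w"
    proof (rule minimizing_type[OF V _ p])
      fix w' p' assume w': "w' \<in> four_types" "w' \<noteq> w" "\<forall>k\<in>labels. region_volume p' w' k = V k"
      then have "C < quadratic_bound V w'" using C by blast
      also have "\<dots> \<le> (\<Sum>j\<le>length w'. 1 + (p' j)\<^sup>2)" using w'(1,3) by (rule quadratic_bound_le)
      finally show "C < (\<Sum>j\<le>length w'. 1 + (p' j)\<^sup>2)" .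
    qed (use w in \<open>auto simp: four_types_def\<close>)
    then show ?thesis using V by blast
  qed
  define U where "U a b c = (\<lambda>k::nat. if k = 1 then a else if k = 2 then b else c)" for a b c :: real
  from assms consider "w0 = [2, 1, 3]" | "w0 = [3, 1, 2, 3]" | "w0 = [2, 3, 1, 3]" | "w0 = [3, 2, 1, 2, 3]"
    by (auto simp: four_types_def)
  then show ?thesis
  proof cases
    case 1
    show ?thesis unfolding 1
      proof (rule by_bounds[of "U (1/10) (1/10) (1/10)" _ "\<lambda>j. [-3/20, -1/20, 1/20, 3/20] ! j" "41/10"])
      show "\<forall>k\<in>labels. region_volume (\<lambda>j. [-3/20, -1/20, 1/20, 3/20] ! j) [2, 1, 3] k = U (1/10) (1/10) (1/10) k"
        unfolding region_volume_four_types U_def by simp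
      show "(\<Sum>j\<le>length [2, 1, 3]. 1 + ([-3/20, -1/20, 1/20, 3/20] ! j)\<^sup>2) \<le> (41/10 :: real)"
        unfolding sum_four_types by (simp add: power2_eq_square)
      show "\<forall>w'\<in>four_types - {[2, 1, 3]}. 41/10 < quadratic_bound (U (1/10) (1/10) (1/10)) w'"
        by (auto simp: four_types_def quadratic_bound_def U_def power2_eq_square)
    qed (auto simp: U_def four_types_def less_Suc_eq le_Suc_eq)
  next
    case 2
    show ?thesis unfolding 2
      proof (rule by_bounds[of "U 1 1 100" _ "\<lambda>j. [-51, -1, 0, 1, 51] ! j" 5209])
      show "\<forall>k\<in>labels. region_volume (\<lambda>j. [-51, -1, 0, 1, 51] ! j) [3, 1, 2, 3] k = U 1 1 100 k"
        unfolding region_volume_four_types U_def by simp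
      show "(\<Sum>j\<le>length [3, 1, 2, 3]. 1 + ([-51, -1, 0, 1, 51] ! j)\<^sup>2) \<le> (5209 :: real)"
        unfolding sum_four_types by (simp add: power2_eq_square)
      show "\<forall>w'\<in>four_types - {[3, 1, 2, 3]}. 5209 < quadratic_bound (U 1 1 100) w'"
        by (auto simp: four_types_def quadratic_bound_def U_def power2_eq_square)
    qed (auto simp: U_def four_types_def less_Suc_eq le_Suc_eq)
  next
    case 3
    show ?thesis unfolding 3
      proof (rule by_bounds[of "U 1 20 40" _ "\<lambda>j. [-27, -7, 0, 1, 34] ! j" 1940])
      show "\<forall>k\<in>labels. region_volume (\<lambda>j. [-27, -7, 0, 1, 34] ! j) [2, 3, 1, 3] k = U 1 20 40 k"
        unfolding region_volume_four_types U_def by simp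
      show "(\<Sum>j\<le>length [2, 3, 1, 3]. 1 + ([-27, -7, 0, 1, 34] ! j)\<^sup>2) \<le> (1940 :: real)"
        unfolding sum_four_types by (simp add: power2_eq_square)
      show "\<forall>w'\<in>four_types - {[2, 3, 1, 3]}. 1940 < quadratic_bound (U 1 20 40) w'"
        by (auto simp: four_types_def quadratic_bound_def U_def power2_eq_square)
    qed (auto simp: U_def four_types_def less_Suc_eq le_Suc_eq)
  next
    case 4
    show ?thesis unfolding 4
      proof (rule by_bounds[of "U 1 20 80" _ "\<lambda>j. [-101/2, -21/2, -1/2, 1/2, 21/2, 101/2] ! j" "10655/2"])
      show "\<forall>k\<in>labels. region_volume (\<lambda>j. [-101/2, -21/2, -1/2, 1/2, 21/2, 101/2] ! j) [3, 2, 1, 2, 3] k = U 1 20 80 k"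
        unfolding region_volume_four_types U_def by simp
      show "(\<Sum>j\<le>length [3, 2, 1, 2, 3]. 1 + ([-101/2, -21/2, -1/2, 1/2, 21/2, 101/2] ! j)\<^sup>2) \<le> (10655/2 :: real)"
        unfolding sum_four_types by (simp add: power2_eq_square)
      show "\<forall>w'\<in>four_types - {[3, 2, 1, 2, 3]}. 10655/2 < quadratic_bound (U 1 20 80) w'"
        by (auto simp: four_types_def quadratic_bound_def U_def power2_eq_square)
    qed (auto simp: U_def four_types_def less_Suc_eq le_Suc_eq)
  qed
qed

theorem theorem1p1:
  shows
    "(\<forall>f V E.
        positive_density f \<and> symmetric_density f \<and> log_convex f \<and> (\<forall>x. x \<noteq> 0 \<longrightarrow> f 0 < f x) \<and>
        0 < V 1 \<and> V 1 \<le> V 2 \<and> V 2 \<le> V 3 \<and> perimeter_minimizing f V E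
        \<longrightarrow> (\<exists>w\<in>four_types. has_type_up_to_reflection_relabelling V E w))
     \<and>
     (\<exists>f. positive_density f \<and> symmetric_density f \<and> strictly_log_convex f \<and>
        f C1_differentiable_on UNIV \<and>
        (\<forall>w\<in>four_types. \<exists>V E.
           0 < V 1 \<and> V 1 \<le> V 2 \<and> V 2 \<le> V 3 \<and> perimeter_minimizing f V E \<and> has_type E w))"
proof (intro conjI allI impI; (elim conjE)?)
  fix f V E
  assume f: "positive_density f" "symmetric_density f" "log_convex f" "\<forall>x. x \<noteq> 0 \<longrightarrow> f 0 < f x"
    and V: "0 < V 1" "V 1 \<le> V 2" "V 2 \<le> V 3" and min: "perimeter_minimizing f V E"
  obtain F where "convex_line_density f F"
    using convex_line_density_exists[of f] f by blast
  then interpret convex_line_density f F .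
  obtain \<sigma> w q where \<sigma>: "\<sigma> permutes labels" "\<forall>k\<in>labels. V (\<sigma> k) = V k" and w: "w \<in> four_types"
    and t: "tiling (E \<circ> \<sigma>) q w \<or> tiling (reflect (E \<circ> \<sigma>)) q w"
    by (rule minimizing_tiling[OF min V]) (rule that)
  then have "has_type (E \<circ> \<sigma>) w \<or> has_type (reflect (E \<circ> \<sigma>)) w"
    using tiling_has_type four_types_labels by blast
  then show "\<exists>w\<in>four_types. has_type_up_to_reflection_relabelling V E w"
    using \<sigma> w unfolding has_type_up_to_reflection_relabelling_def by blast
next
  obtain f where f: "positive_density f" "symmetric_density f" "strictly_log_convex f"
    "f C1_differentiable_on UNIV" "log_convex f" "\<And>x. x \<noteq> 0 \<Longrightarrow> f 0 < f x"
    and sec: "\<And>x. \<bar>x\<bar> \<le> arctan 100 \<Longrightarrow> f x = 1 / (cos x)\<^sup>2"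
    using quadratic_profile_density by metis
  obtain F where F: "convex_line_density f F" "F 0 = 0"
    using convex_line_density_exists[OF f(1,2,5,6)] by blast
  interpret convex_line_density f F by (rule F)
  have "f (inv F t) = 1 + t\<^sup>2" if t: "\<bar>t\<bar> \<le> 100" for t
  proof -
    define c where "c = arctan 100"
    have c: "0 < c" "c < pi / 2" using arctan_ubound by (auto simp: c_def)
    have "\<exists>K. \<forall>x\<in>{- c .. c}. F x - tan x = K"
    proof (rule has_field_derivative_zero_constant)
      fix x assume x: "x \<in> {- c .. c}"
      then have "cos x \<noteq> 0" using cos_gt_zero_pi[of x] c by auto
      moreover have "f x = 1 / (cos x)\<^sup>2" using sec[of x] x by (auto simp: c_def)
      ultimately have "((\<lambda>x. F x - tan x) has_real_derivative 0) (at x)"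
        using DERIV_diff[OF F_deriv DERIV_tan, of x] by (simp add: inverse_eq_divide)
      then show "((\<lambda>x. F x - tan x) has_real_derivative 0) (at x within {- c .. c})"
        by (metis DERIV_subset subset_UNIV)
    qed simp
    then obtain K where K: "\<And>x. x \<in> {- c .. c} \<Longrightarrow> F x - tan x = K" by blast
    have "K = 0" using K[of 0] c F(2) by simp
    have "arctan t \<in> {- c .. c}"
      using t arctan_le_iff[of t 100] arctan_le_iff[of "- 100" t]
      by (auto simp: c_def arctan_minus)
    then have "F (arctan t) = t" and a: "\<bar>arctan t\<bar> \<le> arctan 100"
      using K[of "arctan t"] \<open>K = 0\<close> by (auto simp: tan_arctan c_def abs_le_iff)
    then have "inv F t = arctan t" using inv_F[of "arctan t"] by simp
    moreover have "f (arctan t) = 1 + t\<^sup>2"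
      using sec[OF a] by (simp add: cos_arctan power_divide add_nonneg_nonneg)
    ultimately show ?thesis by simp
  qed
  moreover have "continuous_on UNIV f"
    using f(4) C1_differentiable_imp_continuous_on by blast
  ultimately interpret quadratic_profile f F
    by unfold_locales (use f in auto)
  show "\<exists>f. positive_density f \<and> symmetric_density f \<and> strictly_log_convex f \<and>
        f C1_differentiable_on UNIV \<and>
        (\<forall>w\<in>four_types. \<exists>V E.
           0 < V 1 \<and> V 1 \<le> V 2 \<and> V 2 \<le> V 3 \<and> perimeter_minimizing f V E \<and> has_type E w)"
    using f all_types_occur by blast
qed

end
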